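(* Let $L$ be a connection on $\mathbb{P}^1$ (over $\mathbb{C}$) of rank $m$ having $r>0$ regular singular points $p_1,\dots,p_r$ and no other singularities. Let $t_0(p_i)$ denote the dimension of the local solution space at the point $p_i$. Suppose that at least one $t_0(p_i)$ is zero. Then \[\dim lgl(L)=(r-2)m-\sum_{i=1}^rt_0(p_i).\]
   Context: Here $L$ is given as a global connection $\nabla:\mathbb{C}(z)^m\to\Omega_{\mathbb{C}(z)/\mathbb{C}}^m$ (a $\mathbb{C}$-linear map of the form $\nabla(y)=dy+Ay$ with $A$ an $m\times m$ matrix of rational differential forms). It is assumed that for each point $P\in\mathbb{P}^1$ with local parameter $t$, after a local meromorphic change of basis, $\nabla(y)=dy+A_Py\frac{dt}{t}$ with $A_P$ a constant matrix all of whose eigenvalues have real part in $[0,1)$, and $A_P=0$ if $P\notin\{p_1,\dots,p_r\}$. The local solution space at $p_i$ is the space of germs $y$ of $m$-tuples of meromorphic functions at $p_i$ with $\nabla(y)=0$ (equivalently, solutions in $\mathbb{C}((t))^m$); its dimension $t_0(p_i)$ equals $\dim\ker A_{p_i}$. For $P\in\mathbb{P}^1$ let $K_P\cong\mathbb{C}((t))$ be the completion of $\mathbb{C}(z)$ at $P$ and $\Omega_{K_P}=K_P\,dt$. $lgl(L)$ is the kernel of the natural $\mathbb{C}$-linear map $\Omega_{\mathbb{C}(z)/\mathbb{C}}^m/\nabla(\mathbb{C}(z)^m)\to\prod_{P\in\mathbb{P}^1}\Omega_{K_P}^m/\nabla(K_P^m)$. *)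

theory Defs
  imports
    "HOL-Complex_Analysis.Complex_Analysis"
    "HOL-Computational_Algebra.Computational_Algebra"
    "HOL-Computational_Algebra.Field_as_Ring"
    "HOL-Algebra.AbelCoset"
    "Jordan_Normal_Form.Missing_VectorSpace"
begin

section \<open>Vector spaces over the complex numbers and their quotients\<close>

definition complex_field :: "complex ring" where
  "complex_field = \<lparr>carrier = UNIV, mult = (*), one = 1, zero = 0, add = (+)\<rparr>"

text \<open>The fields \<^term>\<open>mult\<close> and \<^term>\<open>one\<close> of a module record play no role in a module,
  so they are left unspecified here and below.\<close>

definition type_space :: "(complex \<Rightarrow> 'v \<Rightarrow> 'v) \<Rightarrow> (complex, 'v::ab_group_add) module" where
  "type_space sc =
     \<lparr>carrier = UNIV, mult = undefined, one = undefined, zero = 0, add = (+), smult = sc\<rparr>"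

definition quotient_space :: "('k, 'v, 'x) module_scheme \<Rightarrow> 'v set \<Rightarrow> ('k, 'v set) module" where
  "quotient_space V W =
     \<lparr>carrier = a_rcosets\<^bsub>V\<^esub> W, mult = undefined, one = undefined, zero = W, add = set_add V,
      smult = (\<lambda>c C. \<Union>v\<in>C. W +>\<^bsub>V\<^esub> (c \<odot>\<^bsub>V\<^esub> v))\<rparr>"


section \<open>The projective line, rational functions and their expansions\<close>

datatype proj_point = Finite complex | Infinity

definition ratfun_deriv :: "complex poly fract \<Rightarrow> complex poly fract" where
  "ratfun_deriv f = (case quot_of_fract f of (p, q) \<Rightarrow> Fract (pderiv p * q - p * pderiv q) (q\<^sup>2))"

lemma ratfun_deriv_Fract:
  assumes "q \<noteq> 0"
  shows "ratfun_deriv (Fract p q) = Fract (pderiv p * q - p * pderiv q) (q\<^sup>2)"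
proof -
  obtain p' q' where quot: "quot_of_fract (Fract p q) = (p', q')" by fastforce
  have q': "q' \<noteq> 0" using snd_quot_of_fract_nonzero[of "Fract p q"] by (simp add: quot)
  have "Fract p' q' = Fract p q"
    using quot_to_fract_quot_of_fract[of "Fract p q"] by (simp add: quot quot_to_fract_def)
  hence e: "p * q' = p' * q" using q' assms by (simp add: eq_fract)
  from arg_cong[OF e, of pderiv]
  have d: "p * pderiv q' + q' * pderiv p = p' * pderiv q + q * pderiv p'"
    by (simp add: pderiv_mult)
  have "(pderiv p * q - p * pderiv q) * q'\<^sup>2 = (pderiv p' * q' - p' * pderiv q') * q\<^sup>2"
    (is "?l = ?r")
  proof -
    have "?l - ?r = q * q' * ((p * pderiv q' + q' * pderiv p) - (p' * pderiv q + q * pderiv p'))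
                    + (q' * pderiv q + q * pderiv q') * (p' * q - p * q')"
      by (simp add: algebra_simps power2_eq_square)
    also have "\<dots> = 0" by (simp only: d e) simp
    finally show ?thesis by simp
  qed
  thus ?thesis using assms q' by (simp add: ratfun_deriv_def quot eq_fract)
qed

text \<open>The coordinate \<open>z\<close> expressed in the local parameter \<open>t\<close> (written \<^term>\<open>fls_X\<close>), where
  \<open>t = z - a\<close> at the finite point \<open>a\<close> and \<open>t = 1/z\<close> at infinity.  Its \<^term>\<open>fls_deriv\<close> is
  therefore the factor \<open>dz/dt\<close>.\<close>

fun coord_at :: "proj_point \<Rightarrow> complex fls" where
  "coord_at (Finite a) = fls_const a + fls_X"
| "coord_at Infinity = fls_X_inv"

definition poly_at :: "proj_point \<Rightarrow> complex poly \<Rightarrow> complex fls" where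
  "poly_at P p = poly (map_poly fls_const p) (coord_at P)"

lemma poly_at_0 [simp]: "poly_at P 0 = 0"
  by (simp add: poly_at_def)

lemma poly_at_pCons [simp]: "poly_at P (pCons c p) = fls_const c + coord_at P * poly_at P p"
  by (simp add: poly_at_def map_poly_pCons)

lemma poly_at_add: "poly_at P (p + q) = poly_at P p + poly_at P q"
  by (induction p q rule: poly_induct2) (simp_all add: algebra_simps fls_plus_const [symmetric])

lemma poly_at_smult: "poly_at P (Polynomial.smult c p) = fls_const c * poly_at P p"
  by (induction p) (simp_all add: algebra_simps flip: fls_const_mult_const)

lemma poly_at_mult: "poly_at P (p * q) = poly_at P p * poly_at P q"
  by (induction p) (simp_all add: algebra_simps poly_at_add poly_at_smult)

lemma fls_deriv_poly_at: "fls_deriv (poly_at P p) = poly_at P (pderiv p) * fls_deriv (coord_at P)"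
  by (induction p) (simp_all add: pderiv_pCons poly_at_add algebra_simps)

lemma fls_deriv_coord_at_nonzero: "fls_deriv (coord_at P) \<noteq> 0"
  by (cases P) auto

lemma poly_at_eq_0_iff [simp]: "poly_at P p = 0 \<longleftrightarrow> p = 0"
proof
  show "poly_at P p = 0 \<Longrightarrow> p = 0"
  proof (induction "degree p" arbitrary: p)
    case 0
    then obtain c where "p = [:c:]" by (metis degree_eq_zeroE)
    with 0 show ?case by simp
  next
    case (Suc n)
    have "poly_at P (pderiv p) * fls_deriv (coord_at P) = 0"
      using Suc.prems by (simp flip: fls_deriv_poly_at)
    hence "poly_at P (pderiv p) = 0"
      using fls_deriv_coord_at_nonzero[of P] by simp
    moreover have "degree (pderiv p) = n"
      using Suc.hyps(2) by (simp add: degree_pderiv)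
    ultimately have "pderiv p = 0" using Suc.hyps(1) by blast
    with Suc.hyps(2) show ?case by (simp add: pderiv_eq_0_iff)
  qed
qed simp

definition ratfun_at :: "proj_point \<Rightarrow> complex poly fract \<Rightarrow> complex fls" where
  "ratfun_at P f = (case quot_of_fract f of (p, q) \<Rightarrow> poly_at P p / poly_at P q)"

lemma ratfun_at_Fract:
  assumes "q \<noteq> 0"
  shows "ratfun_at P (Fract p q) = poly_at P p / poly_at P q"
proof -
  obtain p' q' where quot: "quot_of_fract (Fract p q) = (p', q')" by fastforce
  have q': "q' \<noteq> 0" using snd_quot_of_fract_nonzero[of "Fract p q"] by (simp add: quot)
  have "Fract p' q' = Fract p q"
    using quot_to_fract_quot_of_fract[of "Fract p q"] by (simp add: quot quot_to_fract_def)
  hence "p * q' = p' * q" using q' assms by (simp add: eq_fract)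
  from arg_cong[OF this, of "poly_at P"] show ?thesis
    using assms q' by (simp add: ratfun_at_def quot poly_at_mult frac_eq_eq)
qed


section \<open>Connections\<close>

text \<open>A form in \<open>\<Omega>\<^sup>m\<close> is represented by its vector of coefficients with respect to \<open>dz\<close>, and a local
  form at a point by its vector of coefficients with respect to \<open>dt\<close>.  The connection
  \<open>y \<mapsto> dy + A y\<close> is represented by the matrix of coefficients of \<open>A\<close> with respect to \<open>dz\<close>.\<close>

definition nabla ::
  "complex poly fract ^ 'm ^ 'm \<Rightarrow> complex poly fract ^ 'm \<Rightarrow> complex poly fract ^ 'm" where
  "nabla A y = (\<chi> i. ratfun_deriv (y $ i)) + A *v y"

definition form_at :: "proj_point \<Rightarrow> complex poly fract ^ 'm \<Rightarrow> complex fls ^ 'm" where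
  "form_at P w = (\<chi> i. ratfun_at P (w $ i) * fls_deriv (coord_at P))"

definition matrix_at :: "proj_point \<Rightarrow> complex poly fract ^ 'm ^ 'm \<Rightarrow> complex fls ^ 'm ^ 'm" where
  "matrix_at P A = (\<chi> i j. ratfun_at P (A $ i $ j) * fls_deriv (coord_at P))"

definition nabla_at ::
  "complex poly fract ^ 'm ^ 'm \<Rightarrow> proj_point \<Rightarrow> complex fls ^ 'm \<Rightarrow> complex fls ^ 'm" where
  "nabla_at A P y = (\<chi> i. fls_deriv (y $ i)) + matrix_at P A *v y"

text \<open>The coefficient of \<open>dt\<close> in \<open>dy + R y dt/t\<close>.\<close>

definition fuchsian_nabla :: "complex ^ 'm ^ 'm \<Rightarrow> complex fls ^ 'm \<Rightarrow> complex fls ^ 'm" where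
  "fuchsian_nabla R y =
     (\<chi> i. fls_deriv (y $ i)) + fls_X_inv *s ((\<chi> i j. fls_const (R $ i $ j)) *v y)"

text \<open>Germs of meromorphic functions at a point are the Laurent series with positive radius of
  convergence.\<close>

definition meromorphic_germ :: "complex fls \<Rightarrow> bool" where
  "meromorphic_germ f \<longleftrightarrow> fls_conv_radius f > 0"

text \<open>The substitution \<open>y = G v\<close> turns \<open>\<nabla>\<close> into \<open>v \<mapsto> dv + R v dt/t\<close>, where \<open>R\<close> has all its
  eigenvalues in the strip \<open>0 \<le> Re < 1\<close>.\<close>

definition local_form_at ::
  "complex poly fract ^ 'm ^ 'm \<Rightarrow> proj_point \<Rightarrow> complex ^ 'm ^ 'm \<Rightarrow> bool" where
  "local_form_at A P R \<longleftrightarrow>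
     (\<exists>G :: complex fls ^ 'm ^ 'm. invertible G \<and> (\<forall>i j. meromorphic_germ (G $ i $ j)) \<and>
        (\<forall>v. nabla_at A P (G *v v) = G *v fuchsian_nabla R v)) \<and>
     (\<forall>ev v. v \<noteq> 0 \<and> R *v v = ev *s v \<longrightarrow> 0 \<le> Re ev \<and> Re ev < 1)"

definition regular_singular :: "complex poly fract ^ 'm ^ 'm \<Rightarrow> proj_point set \<Rightarrow> bool" where
  "regular_singular A S \<longleftrightarrow> (\<forall>P. \<exists>R. local_form_at A P R \<and> (P \<notin> S \<longrightarrow> R = 0))"


section \<open>Local solutions and locally exact forms\<close>

definition global_forms :: "(complex, complex poly fract ^ 'm) module" where
  "global_forms = type_space (\<lambda>c w. to_fract [:c:] *s w)"

definition local_vectors :: "(complex, complex fls ^ 'm) module" where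
  "local_vectors = type_space (\<lambda>c w. fls_const c *s w)"

definition local_solutions ::
  "complex poly fract ^ 'm ^ 'm \<Rightarrow> proj_point \<Rightarrow> (complex, complex fls ^ 'm) module" where
  "local_solutions A P =
     local_vectors\<lparr>carrier := {y. (\<forall>i. meromorphic_germ (y $ i)) \<and> nabla_at A P y = 0}\<rparr>"

definition t0 :: "complex poly fract ^ 'm ^ 'm \<Rightarrow> proj_point \<Rightarrow> nat" where
  "t0 A P = vectorspace.dim complex_field (local_solutions A P)"

definition global_cokernel ::
  "complex poly fract ^ 'm ^ 'm \<Rightarrow> (complex, (complex poly fract ^ 'm) set) module" where
  "global_cokernel A = quotient_space global_forms (range (nabla A))"

definition local_cokernel ::
  "complex poly fract ^ 'm ^ 'm \<Rightarrow> proj_point \<Rightarrow> (complex, (complex fls ^ 'm) set) module" where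
  "local_cokernel A P = quotient_space local_vectors (range (nabla_at A P))"

text \<open>The map induced by \<^const>\<open>form_at\<close> on classes; the union is over representatives of the
  same class and hence a single coset.\<close>

definition localization_map ::
  "complex poly fract ^ 'm ^ 'm \<Rightarrow> (complex poly fract ^ 'm) set
     \<Rightarrow> proj_point \<Rightarrow> (complex fls ^ 'm) set" where
  "localization_map A C =
     (\<lambda>P. \<Union>w\<in>C. range (nabla_at A P) +>\<^bsub>local_vectors\<^esub> form_at P w)"

definition lgl ::
  "complex poly fract ^ 'm ^ 'm \<Rightarrow> (complex, (complex poly fract ^ 'm) set) module" where
  "lgl A = (global_cokernel A)
     \<lparr>carrier := {C \<in> carrier (global_cokernel A).
                   localization_map A C = (\<lambda>P. \<zero>\<^bsub>local_cokernel A P\<^esub>)}\<rparr>"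

end

theory Submission
  imports Defs
begin

text \<open>Let \<open>P0\<close> be a singular point without local solutions. The gauge matrices define a vector bundle
  \<open>M\<close> on the projective line with a logarithmic connection \<open>M \<rightarrow> M \<otimes> \<Omega>(S)\<close> whose residues \<open>R P\<close> have
  eigenvalues with real part in \<open>[0, 1)\<close>. On the coefficients of \<open>t\<^sup>n\<close> the connection acts by \<open>n + R P\<close>,
  which is invertible for \<open>n \<noteq> 0\<close>, and at \<open>P0\<close> for all \<open>n\<close>. Thus a form is locally exact at \<open>P\<close> iff its
  residue vector lies in the range of \<open>R P\<close>, a space of codimension \<open>t0\<close>; this is no condition at \<open>P0\<close>.
  By strong approximation away from \<open>P0\<close>, every locally exact form is, modulo exact ones, a section of
  \<open>M(n P0) \<otimes> \<Omega>(S)\<close> for a fixed large \<open>n\<close>, and such a section is exact iff it is the image of a section of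
  \<open>M(n P0)\<close>. As \<open>\<Omega>(S)\<close> has degree \<open>r - 2\<close>, the two spaces of sections have dimensions differing by
  \<open>(r - 2) m\<close> for large \<open>n\<close>, and local exactness imposes the sum of all \<open>t0\<close> as further independent
  conditions.\<close>

section \<open>Finite-dimensional subspaces of arbitrary vector spaces\<close>

text \<open>The degree of \<open>M\<close> is never computed and no Riemann-Roch theorem is invoked:
  only the difference between the dimensions of \<open>Msec (n + r - 2)\<close> and
  \<open>Msec n\<close> matters. For large \<open>n\<close> every leading coefficient at
  \<open>P0\<close> is realized by a section, so each further order of pole adds exactly
  \<open>m\<close>, whatever the degree of \<open>M\<close> is. Approximation on a projective line
  needs one point where poles are unrestricted. Putting them at \<open>P0\<close> costs nothing: as
  \<open>n + R P0\<close> is invertible for every \<open>n\<close>, poles there can be removed again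
  by exact forms down to a fixed order. The same invertibility makes the connection injective on
  global vectors, so passing from \<open>Msec n\<close> to its image loses no dimension. All spaces
  of sections are complex subspaces of the infinite-dimensional space C(z)^m, where
  \<open>dim\<close> alone says nothing about finiteness. Hence \<open>has_dim\<close> carries a
  finite basis, and finite-dimensionality is proved along with each dimension.\<close>

definition has_dim :: "('k::field \<Rightarrow> 'v::ab_group_add \<Rightarrow> 'v) \<Rightarrow> 'v set \<Rightarrow> nat \<Rightarrow> bool" where
  "has_dim sc X d \<longleftrightarrow>
     (\<exists>B. finite B \<and> \<not> Modules.module.dependent sc B \<and> Modules.module.span sc B = X \<and> card B = d)"

context
  fixes sc :: "'k::field \<Rightarrow> 'v::ab_group_add \<Rightarrow> 'v"
  assumes V: "vector_space sc"
begin

interpretation vs: vector_space sc by (rule V)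

lemma has_dim_imp_dim: "has_dim sc X d \<Longrightarrow> vs.dim X = d"
  by (auto simp: has_dim_def vs.dim_eq_card_independent)

lemma has_dim_subspace: "has_dim sc X d \<Longrightarrow> vs.subspace X"
  by (auto simp: has_dim_def)

lemma has_dim_zero: "has_dim sc {0} 0"
  unfolding has_dim_def by (intro exI[of _ "{}"]) (auto simp: vs.independent_empty)

text \<open>A basis \<open>B1\<close> of \<open>Y\<close> is extended to a basis \<open>B2\<close>
  of \<open>X\<close>, and \<open>Z\<close> is spanned by the new vectors. Such a \<open>Z\<close>
  will later represent locally exact forms modulo exact ones.\<close>

lemma has_dim_complement:
  assumes "has_dim sc X d" "vs.subspace Y" "Y \<subseteq> X"
  obtains e Z where "e \<le> d" "has_dim sc Y e" "has_dim sc Z (d - e)" "Z \<subseteq> X" "Y \<inter> Z = {0}"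
    "\<And>x. x \<in> X \<Longrightarrow> \<exists>y\<in>Y. \<exists>z\<in>Z. x = y + z"
proof -
  obtain B where B: "finite B" "\<not> vs.dependent B" "vs.span B = X" "card B = d"
    using assms(1) by (auto simp: has_dim_def)
  obtain B1 where B1: "B1 \<subseteq> Y" "\<not> vs.dependent B1" "Y \<subseteq> vs.span B1"
    using vs.maximal_independent_subset by blast
  have sB1: "vs.span B1 = Y" using B1 assms(2) by (simp add: vs.span_minimal subset_antisym)
  obtain B2 where B2: "B1 \<subseteq> B2" "B2 \<subseteq> X" "\<not> vs.dependent B2" "X \<subseteq> vs.span B2"
    using vs.maximal_independent_subset_extend[of B1 X] B1 assms(3) by blast
  have sB2: "vs.span B2 = X" using B2 B(3) vs.span_minimal[OF B2(2)] vs.subspace_span[of B] by auto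
  have fB2: "finite B2" using vs.independent_span_bound[OF B(1) B2(3)] B2(2) B(3) by auto
  have fB1: "finite B1" using fB2 B2(1) finite_subset by blast
  have cB2: "card B2 = d"
    using vs.dim_span_eq_card_independent[OF B2(3)] vs.dim_span_eq_card_independent[OF B(2)] B sB2
    by simp
  show ?thesis
  proof
    show "card B1 \<le> d" using cB2 fB2 B2(1) card_mono by blast
    show "has_dim sc Y (card B1)" unfolding has_dim_def using fB1 B1 sB1 by blast
    have "\<not> vs.dependent (B2 - B1)" using vs.independent_mono[OF B2(3)] by blast
    thus "has_dim sc (vs.span (B2 - B1)) (d - card B1)"
      unfolding has_dim_def using fB2 cB2 fB1 B2(1)
      by (intro exI[of _ "B2 - B1"]) (auto simp: card_Diff_subset)
    show "vs.span (B2 - B1) \<subseteq> X" using sB2 vs.span_mono[of "B2 - B1" B2] by auto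
    show "Y \<inter> vs.span (B2 - B1) = {0}"
    proof safe
      fix x assume x: "x \<in> Y" "x \<in> vs.span (B2 - B1)"
      \<comment> \<open>The coordinates of \<open>x\<close> in the basis \<open>B2\<close> are
        supported both in \<open>B1\<close> and in \<open>B2 - B1\<close>, hence they all
        vanish.\<close>
      have r1: "vs.representation B2 x = vs.representation B1 x"
        using vs.representation_extend[of B2 x B1] B2(1,3) x(1) sB1 by auto
      have r2: "vs.representation B2 x = vs.representation (B2 - B1) x"
        using vs.representation_extend[of B2 x "B2 - B1"] B2(3) x(2) by auto
      have z: "vs.representation B2 x b = 0" for b
        using vs.representation_ne_zero[of B1 x b] vs.representation_ne_zero[of "B2 - B1" x b] r1 r2
        by auto
      have "x \<in> vs.span B2" using x(1) assms(3) sB2 by auto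
      from vs.sum_nonzero_representation_eq[OF B2(3) this] z show "x = 0" by simp
    qed (use assms(2) vs.span_zero vs.subspace_0 in auto)
    show "\<exists>y\<in>Y. \<exists>z\<in>vs.span (B2 - B1). x = y + z" if "x \<in> X" for x
    proof -
      have "x \<in> vs.span (B1 \<union> (B2 - B1))" using that sB2 B2(1) by (simp add: Un_absorb1)
      thus ?thesis unfolding vs.span_Un sB1 by auto
    qed
  qed
qed

end

lemma has_dim_subset:
  assumes "vector_space sc" "has_dim sc X d" "Modules.module.subspace sc Y" "Y \<subseteq> X"
  obtains e where "has_dim sc Y e"
  by (rule has_dim_complement[OF assms]) (rule that)

context vector_space_pair
begin

text \<open>A basis of the kernel together with lifts of a basis of the image is a basis of
  \<open>X\<close>. Finite-dimensionality of \<open>X\<close> is part of the conclusion, which lets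
  it be passed from one space of sections to the next.\<close>

lemma has_dim_rank_nullity:
  assumes lf: "Vector_Spaces.linear s1 s2 f" and X: "vs1.subspace X"
    and k: "has_dim s1 {x\<in>X. f x = 0} k" and l: "has_dim s2 (f ` X) l"
  shows "has_dim s1 X (k + l)"
proof -
  interpret f: Vector_Spaces.linear s1 s2 f by (rule lf)
  obtain B where B: "finite B" "vs1.independent B" "vs1.span B = {x\<in>X. f x = 0}" "card B = k"
    using k by (auto simp: has_dim_def)
  obtain C where C: "finite C" "vs2.independent C" "vs2.span C = f ` X" "card C = l"
    using l by (auto simp: has_dim_def)
  have "C \<subseteq> f ` X" using C(3) vs2.span_superset by blast
  then obtain D where D: "D \<subseteq> X" "inj_on f D" "C = f ` D" using subset_image_inj[of C f X] by auto
  have fD: "finite D" using C(1) D finite_image_iff by blast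
  have BX: "B \<subseteq> X" "\<And>b. b \<in> B \<Longrightarrow> f b = 0" using B(3) vs1.span_superset by auto
  have fD0: "f d \<noteq> 0" if "d \<in> D" for d using C(2) D(3) that vs2.dependent_zero[of C] by force
  have disj: "B \<inter> D = {}" using fD0 BX by auto
  have ind: "vs1.independent (B \<union> D)"
  proof (rule vs1.independent_if_scalars_zero)
    fix u x assume s: "(\<Sum>x\<in>B \<union> D. s1 (u x) x) = 0" and x: "x \<in> B \<union> D"
    have s': "(\<Sum>x\<in>B. s1 (u x) x) + (\<Sum>x\<in>D. s1 (u x) x) = 0"
      using s by (simp add: sum.union_disjoint B fD disj)
    have "0 = f ((\<Sum>x\<in>B. s1 (u x) x) + (\<Sum>x\<in>D. s1 (u x) x))" by (simp add: s' f.zero)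
    also have "\<dots> = (\<Sum>x\<in>D. s2 (u x) (f x))" by (simp add: f.add f.sum f.scale BX)
    also have "\<dots> = (\<Sum>c\<in>C. s2 (u (inv_into D f c)) c)"
      unfolding D(3) by (subst sum.reindex[OF D(2)]) (auto simp: D(2) intro!: sum.cong)
    finally have "\<forall>c\<in>C. u (inv_into D f c) = 0"
      using C(1,2) vs2.independent_explicit_finite_subsets[of C, THEN iffD1, rule_format, of C "\<lambda>c. u (inv_into D f c)"] by simp
    hence uD: "u x = 0" if "x \<in> D" for x using that D by auto
    hence "(\<Sum>x\<in>B. s1 (u x) x) = 0" using s' by simp
    hence "\<forall>x\<in>B. u x = 0"
      using B(1,2) vs1.independent_explicit_finite_subsets[of B, THEN iffD1, rule_format, of B u] by simp
    with uD x show "u x = 0" by auto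
  qed (use B fD in auto)
  have sub: "vs1.span (B \<union> D) \<subseteq> X" using BX D(1) X by (intro vs1.span_minimal) auto
  have sup: "X \<subseteq> vs1.span (B \<union> D)"
  proof
    fix x assume x: "x \<in> X"
    have "f x \<in> f ` vs1.span D" using x C(3) D(3) by (simp add: f.span_image)
    then obtain y where y: "y \<in> vs1.span D" "f x = f y" by auto
    have "y \<in> X" using y(1) D(1) X vs1.span_minimal by blast
    hence "x - y \<in> vs1.span B" using B(3) x y(2) X by (simp add: f.diff vs1.subspace_diff)
    hence "(x - y) + y \<in> vs1.span (B \<union> D)" using y(1)
      by (intro vs1.span_add) (meson Un_upper1 Un_upper2 vs1.span_mono subsetD)+
    thus "x \<in> vs1.span (B \<union> D)" by simp
  qed
  have "card (B \<union> D) = k + l"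
    using B C D fD disj by (simp add: card_Un_disjoint card_image)
  thus ?thesis unfolding has_dim_def using B fD ind sub sup
    by (intro exI[of _ "B \<union> D"]) auto
qed

lemma has_dim_injective_image:
  assumes lf: "Vector_Spaces.linear s1 s2 f" and "inj_on f X" and "has_dim s1 X d"
  shows "has_dim s2 (f ` X) d"
proof -
  interpret f: Vector_Spaces.linear s1 s2 f by (rule lf)
  obtain B where B: "finite B" "vs1.independent B" "vs1.span B = X" "card B = d"
    using assms(3) by (auto simp: has_dim_def)
  have BX: "B \<subseteq> X" using B(3) vs1.span_superset by blast
  have "vs2.independent (f ` B)"
    using assms(2) B by (intro f.independent_injective_image) auto
  moreover have "vs2.span (f ` B) = f ` X" by (simp add: f.span_image B)
  moreover have "card (f ` B) = d" using B inj_on_subset[OF assms(2) BX] by (simp add: card_image)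
  ultimately show ?thesis unfolding has_dim_def using B(1) by blast
qed

end

lemma vec_has_dim:
  assumes "vec.subspace (X :: ('a::field ^ 'n) set)"
  shows "has_dim (*s) X (vec.dim X)"
proof -
  obtain B where B: "B \<subseteq> X" "\<not> vec.dependent B" "X \<subseteq> vec.span B" "card B = vec.dim X"
    using vec.basis_exists by blast
  moreover have "vec.span B = X" using B assms vec.span_minimal by blast
  ultimately show ?thesis unfolding has_dim_def using vec.finiteI_independent by blast
qed

lemma field_complex_field: "field complex_field"
proof (rule cring.cring_fieldI2)
  show "cring complex_field"
  proof (intro cringI abelian_groupI comm_monoidI)
    fix x :: complex
    show "\<exists>y\<in>carrier complex_field. y \<oplus>\<^bsub>complex_field\<^esub> x = \<zero>\<^bsub>complex_field\<^esub>"
      by (auto simp: complex_field_def intro!: exI[of _ "- x"])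
  qed (simp_all add: complex_field_def distrib_right)
  fix a assume "a \<in> carrier complex_field" "a \<noteq> \<zero>\<^bsub>complex_field\<^esub>"
  thus "\<exists>b\<in>carrier complex_field. a \<otimes>\<^bsub>complex_field\<^esub> b = \<one>\<^bsub>complex_field\<^esub>"
    by (auto simp: complex_field_def intro!: exI[of _ "inverse a"])
qed (auto simp: complex_field_def)

text \<open>Transport of structure along \<open>T\<close>, from a subspace of a type to a module
  record. The vector space axioms of \<open>U\<close> are themselves pulled back from
  \<open>Z\<close>, so they need no separate proof for \<open>local_solutions\<close> and
  \<open>lgl\<close>.\<close>

lemma vectorspace_dim_eqI:
  fixes U :: "(complex, 'u, 'x) module_scheme" and T :: "'v::ab_group_add \<Rightarrow> 'u"
    and sc :: "complex \<Rightarrow> 'v \<Rightarrow> 'v"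
  assumes V: "vector_space sc" and d: "has_dim sc Z d"
    and T: "bij_betw T Z (carrier U)"
    and zero: "T 0 = \<zero>\<^bsub>U\<^esub>"
    and add: "\<And>x y. x \<in> Z \<Longrightarrow> y \<in> Z \<Longrightarrow> T (x + y) = T x \<oplus>\<^bsub>U\<^esub> T y"
    and smult: "\<And>c x. x \<in> Z \<Longrightarrow> T (sc c x) = c \<odot>\<^bsub>U\<^esub> T x"
  shows "vectorspace.fin_dim complex_field U \<and> vectorspace.dim complex_field U = d"
proof -
  interpret vs: vector_space sc by (rule V)
  have Zs: "vs.subspace Z" using has_dim_subspace[OF V d] .
  note Z = vs.subspace_0[OF Zs] vs.subspace_add[OF Zs] vs.subspace_scale[OF Zs]
    vs.subspace_neg[OF Zs]
  have car: "carrier U = T ` Z" using T by (simp add: bij_betw_def)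
  have inj: "inj_on T Z" using T by (simp add: bij_betw_def)
  note hom = zero[symmetric] add[symmetric] smult[symmetric]
  note cf = complex_field_def
  have Uvs: "vectorspace complex_field U"
  proof (rule vs_criteria[OF field_complex_field], goal_cases)
    case 3
    show ?case
    proof
      fix v assume "v \<in> carrier U"
      then obtain x where "x \<in> Z" "v = T x" by (auto simp: car)
      thus "\<exists>w\<in>carrier U. v \<oplus>\<^bsub>U\<^esub> w = \<zero>\<^bsub>U\<^esub>"
        by (intro bexI[of _ "T (- x)"]) (simp_all add: car hom Z)
    qed
  qed (clarsimp simp: car hom Z cf ac_simps vs.scale_right_distrib vs.scale_left_distrib)+
  interpret U: vectorspace complex_field U by (rule Uvs)
  obtain B where B: "finite B" "\<not> vs.dependent B" "vs.span B = Z" "card B = d"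
    using d by (auto simp: has_dim_def)
  have BZ: "B \<subseteq> Z" using B(3) vs.span_superset by blast
  have inB: "inj_on T B" using inj BZ inj_on_subset by blast
  have lc: "U.lincomb a (T ` B) = T (\<Sum>v\<in>B. sc (a (T v)) v)" for a
  proof -
    have *: "(\<Sum>v\<in>C. sc (a (T v)) v) \<in> Z \<and>
      (\<Oplus>\<^bsub>U\<^esub>v\<in>T ` C. a v \<odot>\<^bsub>U\<^esub> v) = T (\<Sum>v\<in>C. sc (a (T v)) v)" if "finite C" "C \<subseteq> B" for C
      using that
    proof (induction C)
      case empty thus ?case by (simp add: zero Z)
    next
      case (insert x C)
      have xZ: "x \<in> Z" "C \<subseteq> Z" using insert.prems BZ by auto
      have "T x \<notin> T ` C" using insert inB by (auto simp: inj_on_def)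
      moreover have "(\<lambda>v. a v \<odot>\<^bsub>U\<^esub> v) \<in> T ` C \<rightarrow> carrier U" "a (T x) \<odot>\<^bsub>U\<^esub> T x \<in> carrier U"
        using xZ by (auto simp: car smult[symmetric] Z)
      ultimately have "(\<Oplus>\<^bsub>U\<^esub>v\<in>T ` insert x C. a v \<odot>\<^bsub>U\<^esub> v)
          = a (T x) \<odot>\<^bsub>U\<^esub> T x \<oplus>\<^bsub>U\<^esub> (\<Oplus>\<^bsub>U\<^esub>v\<in>T ` C. a v \<odot>\<^bsub>U\<^esub> v)"
        using insert.hyps by simp
      with insert xZ show ?case by (simp add: Z add smult)
    qed
    show ?thesis using *[OF B(1) order_refl] by (simp add: U.lincomb_def)
  qed
  have sumZ: "(\<Sum>v\<in>B. sc (u v) v) \<in> Z" for u using BZ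
    by (intro vs.subspace_sum[OF Zs] vs.subspace_scale[OF Zs]) auto
  have basis: "U.basis (T ` B)"
    unfolding U.basis_def
  proof (intro conjI)
    show "T ` B \<subseteq> carrier U" using BZ car by auto
    show "U.lin_indpt (T ` B)"
    proof (rule U.finite_lin_indpt2)
      fix a assume "U.lincomb a (T ` B) = \<zero>\<^bsub>U\<^esub>"
      hence "T (\<Sum>v\<in>B. sc (a (T v)) v) = T 0" by (simp add: lc zero)
      hence "(\<Sum>v\<in>B. sc (a (T v)) v) = 0" using inj sumZ[of "\<lambda>v. a (T v)"] Z by (auto simp: inj_on_def)
      hence "\<forall>v\<in>B. a (T v) = 0"
        using B(1,2) vs.independent_explicit_finite_subsets[of B, THEN iffD1, rule_format, of B "\<lambda>v. a (T v)"] by simp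
      thus "\<forall>v\<in>T ` B. a v = \<zero>\<^bsub>complex_field\<^esub>" by (simp add: cf)
    qed (use B(1) BZ car in auto)
    show "U.span (T ` B) = carrier U"
    proof
      show "U.span (T ` B) \<subseteq> carrier U"
        using BZ car by (intro U.span_is_subset2) auto
      show "carrier U \<subseteq> U.span (T ` B)"
      proof
        fix y assume "y \<in> carrier U"
        then obtain x where x: "x \<in> Z" "y = T x" by (auto simp: car)
        obtain u where u: "x = (\<Sum>v\<in>B. sc (u v) v)"
          using x(1) B(1,3) vs.span_finite[of B] by auto
        have "y = U.lincomb (\<lambda>w. u (inv_into B T w)) (T ` B)"
          using inB by (simp add: lc x(2) u)
        thus "y \<in> U.span (T ` B)"
          using B(1) unfolding U.span_def by (auto simp: cf)
      qed
    qed
  qed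
  have "U.dim = d" using U.dim_basis[OF _ basis] B(1,4) inB by (simp add: card_image)
  moreover have "U.fin_dim" unfolding U.fin_dim_def using basis B(1) by (auto simp: U.basis_def)
  ultimately show ?thesis by simp
qed

section \<open>Expansions and orders of rational functions\<close>

text \<open>Stated by coefficients so that 0 satisfies every bound; \<open>fls_subdegree\<close>
  assigns order 0 to the zero series.\<close>

definition ord_ge :: "int \<Rightarrow> complex fls \<Rightarrow> bool" where
  "ord_ge n x \<longleftrightarrow> (\<forall>k<n. fls_nth x k = 0)"

lemma ord_ge_iff: "ord_ge n x \<longleftrightarrow> x = 0 \<or> n \<le> fls_subdegree x"
proof
  assume v: "ord_ge n x"
  have "n \<le> fls_subdegree x" if "x \<noteq> 0"
  proof (rule ccontr)
    assume "\<not> n \<le> fls_subdegree x"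
    hence "fls_nth x (fls_subdegree x) = 0" using v by (auto simp: ord_ge_def)
    thus False using that by simp
  qed
  thus "x = 0 \<or> n \<le> fls_subdegree x" by blast
qed (auto simp: ord_ge_def)

lemma ord_ge_0 [simp]: "ord_ge n 0" by (simp add: ord_ge_def)
lemma ord_ge_add: "ord_ge n x \<Longrightarrow> ord_ge n y \<Longrightarrow> ord_ge n (x + y)" by (simp add: ord_ge_def)
lemma ord_ge_diff: "ord_ge n x \<Longrightarrow> ord_ge n y \<Longrightarrow> ord_ge n (x - y)" by (simp add: ord_ge_def)
lemma ord_ge_sum: "(\<And>i. i \<in> I \<Longrightarrow> ord_ge n (f i)) \<Longrightarrow> ord_ge n (\<Sum>i\<in>I. f i)"
  by (induction I rule: infinite_finite_induct) (auto intro: ord_ge_add)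
lemma ord_ge_mono: "ord_ge n x \<Longrightarrow> k \<le> n \<Longrightarrow> ord_ge k x" by (simp add: ord_ge_def)
lemma ord_ge_mult: "ord_ge a x \<Longrightarrow> ord_ge b y \<Longrightarrow> ord_ge (a + b) (x * y)"
  by (cases "x = 0 \<or> y = 0") (auto simp: ord_ge_iff)
lemma ord_ge_mult': "ord_ge a x \<Longrightarrow> ord_ge b y \<Longrightarrow> n \<le> a + b \<Longrightarrow> ord_ge n (x * y)"
  using ord_ge_mult ord_ge_mono by blast
lemma ord_ge_const: "ord_ge 0 (fls_const c)" by (auto simp: ord_ge_def)
lemma ord_ge_exists: "\<exists>n\<ge>0. ord_ge (- n) x"
  by (rule exI[of _ "\<bar>fls_subdegree x\<bar>"]) (auto simp: ord_ge_iff)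

lemma ord_ge_mult_left_iff: "x \<noteq> 0 \<Longrightarrow> ord_ge n (x * y) \<longleftrightarrow> ord_ge (n - fls_subdegree x) y"
  by (cases "y = 0") (auto simp: ord_ge_iff)

lemma poly_at_1 [simp]: "poly_at P 1 = 1"
  by (simp add: poly_at_def)

lemma poly_at_uminus: "poly_at P (- p) = - poly_at P p"
  using poly_at_add[of P p "- p"] by (simp add: eq_neg_iff_add_eq_0 add.commute)

lemma ratfun_at_add: "ratfun_at P (f + g) = ratfun_at P f + ratfun_at P g"
proof (cases f; cases g)
  fix a b c d assume "f = Fract a b" "b \<noteq> 0" "g = Fract c d" "d \<noteq> (0 :: complex poly)"
  thus ?thesis
    by (simp add: ratfun_at_Fract poly_at_add poly_at_mult divide_simps)
qed

lemma ratfun_at_mult: "ratfun_at P (f * g) = ratfun_at P f * ratfun_at P g"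
proof (cases f; cases g)
  fix a b c d assume "f = Fract a b" "b \<noteq> 0" "g = Fract c d" "d \<noteq> (0 :: complex poly)"
  thus ?thesis
    by (simp add: ratfun_at_Fract poly_at_mult)
qed

lemma ratfun_at_to_fract: "ratfun_at P (to_fract p) = poly_at P p"
  by (simp add: to_fract_def ratfun_at_Fract)

lemma ratfun_at_const: "ratfun_at P (to_fract [:c:]) = fls_const c"
  by (simp add: ratfun_at_to_fract)

lemma ratfun_at_0 [simp]: "ratfun_at P 0 = 0"
  by (simp add: ratfun_at_Fract Zero_fract_def)

lemma ratfun_at_1 [simp]: "ratfun_at P 1 = 1"
  by (simp add: ratfun_at_Fract One_fract_def)

lemma ratfun_at_eq_0_iff [simp]: "ratfun_at P f = 0 \<longleftrightarrow> f = 0"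
proof (cases f)
  case (Fract a b)
  thus ?thesis by (auto simp: ratfun_at_Fract Zero_fract_def eq_fract)
qed

lemma ratfun_at_uminus: "ratfun_at P (- f) = - ratfun_at P f"
  using ratfun_at_add[of P f "- f"] by (simp add: eq_neg_iff_add_eq_0 add.commute)

lemma ratfun_at_diff: "ratfun_at P (f - g) = ratfun_at P f - ratfun_at P g"
  using ratfun_at_add[of P f "- g"] by (simp add: ratfun_at_uminus)

lemma ratfun_at_sum: "ratfun_at P (\<Sum>i\<in>I. f i) = (\<Sum>i\<in>I. ratfun_at P (f i))"
  by (induction I rule: infinite_finite_induct) (auto simp: ratfun_at_add)

lemma ratfun_at_deriv: "fls_deriv (ratfun_at P f) = ratfun_at P (ratfun_deriv f) * fls_deriv (coord_at P)"
proof (cases f)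
  case (Fract a b)
  have nz: "poly_at P b \<noteq> 0" using Fract by simp
  have "poly_at P a = ratfun_at P f * poly_at P b" using Fract nz by (simp add: ratfun_at_Fract)
  from arg_cong[OF this, of fls_deriv] have "poly_at P (pderiv a) * fls_deriv (coord_at P) =
    fls_deriv (ratfun_at P f) * poly_at P b + ratfun_at P f * (poly_at P (pderiv b) * fls_deriv (coord_at P))"
    by (simp add: fls_deriv_poly_at algebra_simps)
  hence h: "fls_deriv (ratfun_at P f) * (poly_at P b * poly_at P b)
      = (poly_at P (pderiv a) * poly_at P b - poly_at P a * poly_at P (pderiv b)) * fls_deriv (coord_at P)"
    using Fract nz by (simp add: ratfun_at_Fract field_simps)
  have "ratfun_at P (ratfun_deriv f)
      = (poly_at P (pderiv a) * poly_at P b - poly_at P a * poly_at P (pderiv b)) / (poly_at P b * poly_at P b)"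
    using Fract poly_at_add[of P "pderiv a * b" "- (a * pderiv b)"]
    by (simp add: ratfun_deriv_Fract ratfun_at_Fract poly_at_mult poly_at_uminus power2_eq_square)
  hence "ratfun_at P (ratfun_deriv f) * fls_deriv (coord_at P)
      = fls_deriv (ratfun_at P f) * (poly_at P b * poly_at P b) / (poly_at P b * poly_at P b)"
    unfolding h by simp
  thus ?thesis using nz by simp
qed

text \<open>Expansion at a single point is an injective ring homomorphism that respects derivatives
  up to the nonzero factor dz/dt, so the identity may be checked on Laurent series.\<close>

lemma ratfun_deriv_add: "ratfun_deriv (f + g) = ratfun_deriv f + ratfun_deriv g"
proof -
  let ?P = "Finite 0"
  have "ratfun_at ?P (ratfun_deriv (f + g) - (ratfun_deriv f + ratfun_deriv g)) * fls_deriv (coord_at ?P) = 0"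
    by (simp only: ratfun_at_diff ratfun_at_add left_diff_distrib distrib_right ratfun_at_deriv[symmetric]) simp
  thus ?thesis by (simp add: fls_deriv_coord_at_nonzero del: coord_at.simps)
qed

definition val :: "proj_point \<Rightarrow> complex poly fract \<Rightarrow> int" where
  "val P f = fls_subdegree (ratfun_at P f)"

lemma val_mult: "f \<noteq> 0 \<Longrightarrow> g \<noteq> 0 \<Longrightarrow> val P (f * g) = val P f + val P g"
  by (simp add: val_def ratfun_at_mult)

lemma val_1 [simp]: "val P 1 = 0"
  by (simp add: val_def)

lemma val_inverse: "val P (inverse f) = - val P f"
proof (cases "f = 0")
  case False
  hence "val P f + val P (inverse f) = val P (f * inverse f)" by (intro val_mult[symmetric]) auto
  also have "\<dots> = 0" by (simp only: right_inverse[OF False] val_1)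
  finally show ?thesis by simp
qed (simp add: val_def)

lemma val_powi:
  assumes f: "f \<noteq> 0"
  shows "val P (f powi n) = n * val P f"
proof -
  have pow: "val P (g ^ k) = int k * val P g" if "g \<noteq> 0" for g k
    by (induction k) (auto simp: val_mult that algebra_simps)
  show ?thesis
    using pow[OF f] pow[of "inverse f"] f by (auto simp: power_int_def val_inverse)
qed

lemma val_prod: "finite I \<Longrightarrow> (\<And>i. i \<in> I \<Longrightarrow> f i \<noteq> 0) \<Longrightarrow> val P (\<Prod>i\<in>I. f i) = (\<Sum>i\<in>I. val P (f i))"
  by (induction I rule: finite_induct) (auto simp: val_mult)

lemma ord_ge_ratfun_iff: "ord_ge n (ratfun_at P f) \<longleftrightarrow> f = 0 \<or> n \<le> val P f"
  by (auto simp: ord_ge_iff val_def)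

lemma poly_at_Finite: "poly_at (Finite a) p = fps_to_fls (fps_of_poly (p \<circ>\<^sub>p [:a, 1:]))"
proof (induction p)
  case (pCons c p)
  have c: "coord_at (Finite a) = fps_to_fls (fps_of_poly [:a, 1:])"
    by (simp add: fps_of_poly_pCons)
  have "fps_to_fls (fps_of_poly (pCons c p \<circ>\<^sub>p [:a, 1:])) =
      fps_to_fls (fps_of_poly [:c:]) + fps_to_fls (fps_of_poly ([:a, 1:] * (p \<circ>\<^sub>p [:a, 1:])))"
    by (simp only: pcompose_pCons fps_of_poly_add fps_to_fls_plus)
  also have "fps_to_fls (fps_of_poly ([:a, 1:] * (p \<circ>\<^sub>p [:a, 1:]))) = coord_at (Finite a) * poly_at (Finite a) p"
    by (simp only: c pCons fps_of_poly_mult fls_times_fps_to_fls)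
  also have "fps_to_fls (fps_of_poly [:c:]) = fls_const c" by simp
  finally show ?case by simp
qed simp

lemma val_Finite_poly_nonneg: "0 \<le> fls_subdegree (poly_at (Finite a) p)"
  by (simp add: poly_at_Finite fls_subdegree_fls_to_fps)

lemma poly_at_Finite_nth_0: "fls_nth (poly_at (Finite a) p) 0 = poly p a"
  by (simp add: poly_at_Finite poly_0_coeff_0[symmetric] poly_pcompose)

lemma val_Finite_poly_eq_0: "poly p a \<noteq> 0 \<Longrightarrow> fls_subdegree (poly_at (Finite a) p) = 0"
  using poly_at_Finite_nth_0[of a p] val_Finite_poly_nonneg[of a p]
  by (metis fls_subdegree_leI order_antisym)

lemma val_Finite_poly_pos: "p \<noteq> 0 \<Longrightarrow> poly p a = 0 \<Longrightarrow> 0 < fls_subdegree (poly_at (Finite a) p)"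
  using poly_at_Finite_nth_0[of a p] val_Finite_poly_nonneg[of a p]
  by (metis nth_fls_subdegree_nonzero order_less_le poly_at_eq_0_iff)

lemma subdegree_poly_at_Infinity: "fls_subdegree (poly_at Infinity p) = - int (degree p)"
proof (induction p)
  case (pCons c p)
  show ?case
  proof (cases "p = 0")
    case False
    hence "poly_at Infinity p \<noteq> 0" by simp
    hence s: "fls_subdegree (fls_X_inv * poly_at Infinity p) = - int (degree p) - 1"
      using pCons by simp
    show ?thesis using False s
      by (simp del: fls_X_inv_times_conv_shift) (subst fls_subdegree_add_eq2; auto simp: s simp del: fls_X_inv_times_conv_shift)
  qed simp
qed simp

lemma finite_val_nonzero: "finite {P. val P f \<noteq> 0}"
proof (cases f)
  case (Fract a b)
  show ?thesis
  proof (cases "a = 0")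
    case True
    hence "f = 0" using Fract by (simp add: Zero_fract_def eq_fract)
    thus ?thesis by (simp add: val_def)
  next
    case False
    have "val (Finite x) f = 0" if "poly a x \<noteq> 0" "poly b x \<noteq> 0" for x
      using Fract False that by (simp add: val_def ratfun_at_Fract fls_divide_subdegree val_Finite_poly_eq_0)
    hence "{P. val P f \<noteq> 0} \<subseteq> insert Infinity (Finite ` ({x. poly a x = 0} \<union> {x. poly b x = 0}))"
    proof -
      have "P \<in> insert Infinity (Finite ` ({x. poly a x = 0} \<union> {x. poly b x = 0}))" if "val P f \<noteq> 0" for P
        using that \<open>\<And>x. poly a x \<noteq> 0 \<Longrightarrow> poly b x \<noteq> 0 \<Longrightarrow> val (Finite x) f = 0\<close> by (cases P) auto
      thus ?thesis by blast
    qed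
    thus ?thesis using False Fract by (elim finite_subset) (simp add: poly_roots_finite)
  qed
qed

text \<open>A rational function without poles is constant: by the fundamental theorem of algebra its
  reduced denominator is constant, and without a pole at infinity so is the numerator. The zero at
  \<open>P0\<close> kills the constant.\<close>

lemma ratfun_eq_0I:
  assumes nonneg: "\<And>P. ord_ge 0 (ratfun_at P f)" and pos: "ord_ge 1 (ratfun_at P0 f)"
  shows "f = 0"
proof -
  obtain p q where pq: "quot_of_fract f = (p, q)" by fastforce
  have q: "q \<noteq> 0" using snd_quot_of_fract_nonzero[of f] pq by simp
  have f: "f = Fract p q" using Fract_quot_of_fract[of f] pq by simp
  have co: "coprime p q" using coprime_quot_of_fract[of f] pq by simp
  have nor: "poly q a \<noteq> 0" for a
  proof
    assume a: "poly q a = 0"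
    hence "[:-a, 1:] dvd q" by (simp add: poly_eq_0_iff_dvd)
    hence "\<not> [:-a, 1:] dvd p" using co
      by (auto dest!: coprime_common_divisor simp: is_unit_iff_degree)
    hence pa: "poly p a \<noteq> 0" by (simp add: poly_eq_0_iff_dvd)
    hence "p \<noteq> 0" by auto
    have "val (Finite a) f < 0" using \<open>p \<noteq> 0\<close> q pa val_Finite_poly_pos[OF q a]
      by (simp add: val_def f ratfun_at_Fract fls_divide_subdegree val_Finite_poly_eq_0)
    moreover have "f \<noteq> 0" using \<open>p \<noteq> 0\<close> q f by (simp add: Zero_fract_def eq_fract)
    ultimately show False using nonneg[of "Finite a"] by (simp add: ord_ge_ratfun_iff)
  qed
  have "constant (poly q)" using nor fundamental_theorem_of_algebra by blast
  hence dq: "degree q = 0" by (simp add: constant_degree)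
  have "degree p = 0"
  proof (cases "p = 0")
    case False
    hence "f \<noteq> 0" using q f by (simp add: Zero_fract_def eq_fract)
    hence "0 \<le> val Infinity f" using nonneg[of Infinity] by (simp add: ord_ge_ratfun_iff)
    thus ?thesis using False q dq
      by (simp add: val_def f ratfun_at_Fract fls_divide_subdegree subdegree_poly_at_Infinity)
  qed auto
  then obtain c d where cd: "p = [:c:]" "q = [:d:]" using dq by (metis degree_eq_zeroE)
  have "ratfun_at P0 f = fls_const (c / d)"
    using q by (simp add: f cd ratfun_at_Fract fls_const_divide_const)
  hence "c / d = 0" using pos by (auto simp: ord_ge_def dest!: spec[of _ 0])
  thus "f = 0" using q by (simp add: f cd Zero_fract_def eq_fract)
qed

section \<open>Strong approximation on the projective line\<close>

text \<open>The homogeneous linear form vanishing at the point, written in the affine coordinate.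
  Each value has divisor "point minus infinity", hence 1 at infinity itself.\<close>

fun lin_poly :: "proj_point \<Rightarrow> complex poly" where
  "lin_poly (Finite a) = [:- a, 1:]"
| "lin_poly Infinity = 1"

lemma lin_poly_nonzero [simp]: "lin_poly P \<noteq> 0"
  by (cases P) auto

lemma subdegree_lin_poly: "fls_subdegree (poly_at R (lin_poly P)) = of_bool (R = P) - of_bool (R = Infinity)"
proof (cases R)
  case R: (Finite b)
  show ?thesis
  proof (cases "P = R")
    case True
    have "poly_at R (lin_poly P) = fls_X" by (simp add: True R fls_minus_const)
    thus ?thesis using True R by simp
  next
    case False
    hence "poly (lin_poly P) b \<noteq> 0" using R by (cases P) auto
    thus ?thesis using False R by (simp add: val_Finite_poly_eq_0)
  qed
next
  case Infinity
  thus ?thesis by (cases P) (simp_all only: subdegree_poly_at_Infinity, simp_all)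
qed

text \<open>The divisor of \<open>pole_zero P Q\<close> is \<open>Q - P\<close>.\<close>

definition pole_zero :: "proj_point \<Rightarrow> proj_point \<Rightarrow> complex poly fract" where
  "pole_zero P Q = Fract (lin_poly Q) (lin_poly P)"

lemma pole_zero_nonzero [simp]: "pole_zero P Q \<noteq> 0"
  by (simp add: pole_zero_def Zero_fract_def eq_fract)

lemma val_pole_zero: "val R (pole_zero P Q) = of_bool (R = Q) - of_bool (R = P)"
  by (simp add: val_def pole_zero_def ratfun_at_Fract fls_divide_subdegree subdegree_lin_poly)

text \<open>Induction on the number \<open>k\<close> of coefficients of \<open>g\<close> still to be
  matched below order \<open>N\<close>; each step removes the lowest one by a function whose other
  zeros and poles lie at \<open>P0\<close> only.\<close>

lemma approx_one:
  assumes "P \<noteq> P0"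
  shows "\<exists>f. ord_ge N (ratfun_at P f - g) \<and> (\<forall>Q. Q \<noteq> P \<and> Q \<noteq> P0 \<longrightarrow> ord_ge 0 (ratfun_at Q f))"
proof -
  have "\<exists>f. ord_ge N (ratfun_at P f - g) \<and> (\<forall>Q. Q \<noteq> P \<and> Q \<noteq> P0 \<longrightarrow> ord_ge 0 (ratfun_at Q f))"
    if "ord_ge (N - int k) g" for k g
    using that
  proof (induction k arbitrary: g)
    case 0
    thus ?case by (intro exI[of _ 0]) (simp add: ord_ge_def)
  next
    case (Suc k)
    define n where "n = N - int (Suc k)"
    \<comment> \<open>The divisor of \<open>h\<close> is \<open>n\<close> times P - P0, so at
      \<open>P\<close> it starts exactly with the coefficient that has to be matched.\<close>
    define h where "h = pole_zero P P0 powi (- n)"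
    have h0: "h \<noteq> 0" by (simp add: h_def)
    have vh: "val Q h = of_bool (Q = P) * n - of_bool (Q = P0) * n" for Q
      by (simp add: h_def val_powi val_pole_zero algebra_simps)
    define l where "l = fls_nth (ratfun_at P h) n"
    have vP: "val P h = n" using vh[of P] assms by simp
    have l: "l \<noteq> 0" using h0 unfolding l_def vP[unfolded val_def, symmetric] by simp
    have vhP: "ord_ge n (ratfun_at P h)" using vh[of P] assms by (simp add: ord_ge_ratfun_iff)
    define f1 where "f1 = to_fract [:fls_nth g n / l:] * h"
    have f1: "ratfun_at Q f1 = fls_const (fls_nth g n / l) * ratfun_at Q h" for Q
      by (simp add: f1_def ratfun_at_mult ratfun_at_const)
    have "ord_ge (N - int k) (g - ratfun_at P f1)"
      unfolding ord_ge_def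
    proof safe
      fix j assume "j < N - int k"
      hence "j < n \<or> j = n" by (auto simp: n_def)
      thus "fls_nth (g - ratfun_at P f1) j = 0"
        using Suc.prems[folded n_def] vhP l by (auto simp: ord_ge_def f1 l_def[symmetric])
    qed
    from Suc.IH[OF this] obtain f where f: "ord_ge N (ratfun_at P f - (g - ratfun_at P f1))"
      "\<forall>Q. Q \<noteq> P \<and> Q \<noteq> P0 \<longrightarrow> ord_ge 0 (ratfun_at Q f)" by blast
    have "ord_ge 0 (ratfun_at Q f1)" if "Q \<noteq> P" "Q \<noteq> P0" for Q
      unfolding f1 using that by (intro ord_ge_mult'[OF ord_ge_const, of 0]) (auto simp: ord_ge_ratfun_iff vh)
    with f show ?case
      by (intro exI[of _ "f + f1"]) (auto simp: ratfun_at_add algebra_simps intro: ord_ge_add)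
  qed
  moreover obtain n where "n \<ge> 0" "ord_ge (- n) g" using ord_ge_exists by blast
  hence "ord_ge (N - int (nat (N + n))) g" by (elim ord_ge_mono) auto
  ultimately show ?thesis by blast
qed

text \<open>Approximate \<open>g / w\<close> and multiply by \<open>w\<close>, where
  \<open>w\<close> vanishes on \<open>T\<close>, has order 0 at \<open>P\<close> and may have poles
  only at \<open>P0\<close>.\<close>

lemma approx_one_vanishing:
  assumes "P \<noteq> P0" "finite T" "P \<notin> T" "P0 \<notin> T"
  shows "\<exists>f. ord_ge N (ratfun_at P f - g) \<and> (\<forall>Q\<in>T. ord_ge N (ratfun_at Q f)) \<and>
    (\<forall>Q. Q \<noteq> P \<and> Q \<noteq> P0 \<longrightarrow> ord_ge 0 (ratfun_at Q f))"
proof -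
  \<comment> \<open>For negative \<open>N\<close>, the maximum keeps \<open>w\<close> from having
    poles on \<open>T\<close>, where the result must be holomorphic too.\<close>
  define n where "n = max N 0"
  define w where "w = (\<Prod>Q\<in>T. pole_zero Q P0 powi (- n))"
  have w0: "w \<noteq> 0" using assms(2) by (simp add: w_def)
  have vw: "val R w = of_bool (R \<in> T) * n" if "R \<noteq> P0" for R
  proof -
    have "val R w = (\<Sum>Q\<in>T. if Q = R then n else 0)"
      unfolding w_def using assms(2) that
      by (subst val_prod) (auto simp: val_powi val_pole_zero intro!: sum.cong)
    thus ?thesis using assms(2) by simp
  qed
  obtain f where f: "ord_ge N (ratfun_at P f - g / ratfun_at P w)"
    "\<And>Q. Q \<noteq> P \<Longrightarrow> Q \<noteq> P0 \<Longrightarrow> ord_ge 0 (ratfun_at Q f)"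
    using approx_one[OF assms(1), of N "g / ratfun_at P w"] by blast
  show ?thesis
  proof (intro exI[of _ "w * f"] conjI ballI allI impI)
    have "ratfun_at P (w * f) - g = ratfun_at P w * (ratfun_at P f - g / ratfun_at P w)"
      using w0 by (simp add: ratfun_at_mult algebra_simps)
    moreover have "ord_ge (0 + N) (ratfun_at P w * (ratfun_at P f - g / ratfun_at P w))"
      using vw[of P] assms f(1) by (intro ord_ge_mult) (auto simp: ord_ge_ratfun_iff)
    ultimately show "ord_ge N (ratfun_at P (w * f) - g)" by simp
  next
    fix Q assume "Q \<in> T"
    moreover from this have "Q \<noteq> P" "Q \<noteq> P0" using assms by auto
    ultimately show "ord_ge N (ratfun_at Q (w * f))" using f(2)[of Q] vw[of Q]
      unfolding ratfun_at_mult by (intro ord_ge_mult'[of n _ 0]) (auto simp: ord_ge_ratfun_iff n_def)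
  next
    fix Q assume "Q \<noteq> P \<and> Q \<noteq> P0"
    thus "ord_ge 0 (ratfun_at Q (w * f))" using f(2)[of Q] vw[of Q] assms
      unfolding ratfun_at_mult by (intro ord_ge_mult'[of 0 _ 0]) (auto simp: ord_ge_ratfun_iff n_def)
  qed
qed

text \<open>The sum of functions \<open>F P\<close>, each close to \<open>g P\<close> at its own
  point and small at the other points of \<open>T\<close>, as in the Chinese remainder
  theorem.\<close>

lemma approximation:
  assumes "finite T" "P0 \<notin> T"
  shows "\<exists>f. (\<forall>P\<in>T. ord_ge N (ratfun_at P f - g P)) \<and>
    (\<forall>Q. Q \<notin> T \<and> Q \<noteq> P0 \<longrightarrow> ord_ge 0 (ratfun_at Q f))"
proof -
  have "\<exists>f. ord_ge N (ratfun_at P f - g P) \<and> (\<forall>Q\<in>T - {P}. ord_ge N (ratfun_at Q f)) \<and>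
    (\<forall>Q. Q \<noteq> P \<and> Q \<noteq> P0 \<longrightarrow> ord_ge 0 (ratfun_at Q f))" if "P \<in> T" for P
    using that assms by (intro approx_one_vanishing) auto
  then obtain F where F: "\<And>P. P \<in> T \<Longrightarrow> ord_ge N (ratfun_at P (F P) - g P)"
    "\<And>P Q. P \<in> T \<Longrightarrow> Q \<in> T - {P} \<Longrightarrow> ord_ge N (ratfun_at Q (F P))"
    "\<And>P Q. P \<in> T \<Longrightarrow> Q \<noteq> P \<Longrightarrow> Q \<noteq> P0 \<Longrightarrow> ord_ge 0 (ratfun_at Q (F P))" by metis
  show ?thesis
  proof (intro exI[of _ "\<Sum>P\<in>T. F P"] conjI ballI allI impI)
    fix P assume P: "P \<in> T"
    have "ratfun_at P (\<Sum>P\<in>T. F P) - g P = (ratfun_at P (F P) - g P) + (\<Sum>Q\<in>T - {P}. ratfun_at P (F Q))"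
      using P assms(1) by (simp add: ratfun_at_sum ratfun_at_add sum.remove[OF assms(1) P])
    also have "ord_ge N \<dots>" using F P by (intro ord_ge_add ord_ge_sum) auto
    finally show "ord_ge N (ratfun_at P (\<Sum>P\<in>T. F P) - g P)" .
  next
    fix Q assume "Q \<notin> T \<and> Q \<noteq> P0"
    thus "ord_ge 0 (ratfun_at Q (\<Sum>P\<in>T. F P))"
      unfolding ratfun_at_sum by (intro ord_ge_sum F(3)) auto
  qed
qed

section \<open>Local analysis of a Fuchsian connection\<close>

definition vec_coeff :: "complex fls ^ 'm \<Rightarrow> int \<Rightarrow> complex ^ 'm" where
  "vec_coeff v n = (\<chi> i. fls_nth (v $ i) n)"

definition vec_ord_ge :: "int \<Rightarrow> complex fls ^ 'm \<Rightarrow> bool" where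
  "vec_ord_ge n v \<longleftrightarrow> (\<forall>i. ord_ge n (v $ i))"

lemma vec_ord_ge_iff_vec_coeff: "vec_ord_ge n v \<longleftrightarrow> (\<forall>k<n. vec_coeff v k = 0)"
  by (auto simp: vec_ord_ge_def ord_ge_def vec_coeff_def vec_eq_iff)

lemma vec_ord_ge_0 [simp]: "vec_ord_ge n 0" by (simp add: vec_ord_ge_def)
lemma vec_ord_ge_add: "vec_ord_ge n v \<Longrightarrow> vec_ord_ge n w \<Longrightarrow> vec_ord_ge n (v + w)" by (simp add: vec_ord_ge_def ord_ge_add)
lemma vec_ord_ge_diff: "vec_ord_ge n v \<Longrightarrow> vec_ord_ge n w \<Longrightarrow> vec_ord_ge n (v - w)" by (simp add: vec_ord_ge_def ord_ge_diff)
lemma vec_ord_ge_mono: "vec_ord_ge n v \<Longrightarrow> k \<le> n \<Longrightarrow> vec_ord_ge k v" by (meson vec_ord_ge_def ord_ge_mono)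
lemma vec_ord_ge_scale: "ord_ge a c \<Longrightarrow> vec_ord_ge b v \<Longrightarrow> n \<le> a + b \<Longrightarrow> vec_ord_ge n (c *s v)"
  unfolding vec_ord_ge_def by (auto intro: ord_ge_mult')
lemma vec_ord_ge_scale_iff: "c \<noteq> 0 \<Longrightarrow> vec_ord_ge n (c *s v) \<longleftrightarrow> vec_ord_ge (n - fls_subdegree c) v"
  by (simp add: vec_ord_ge_def ord_ge_mult_left_iff)
lemma vec_ord_ge_matrix:
  fixes M :: "complex fls ^ 'm ^ 'k"
  assumes "\<And>i j. ord_ge a (M $ i $ j)" "vec_ord_ge b v" "n \<le> a + b"
  shows "vec_ord_ge n (M *v v)"
  using assms unfolding vec_ord_ge_def matrix_vector_mult_def by (auto intro!: ord_ge_sum ord_ge_mult'[of a _ b])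
lemma vec_ord_ge_exists: "\<exists>n\<ge>0. vec_ord_ge (- n) v"
proof -
  define n where "n i = (SOME n. n \<ge> 0 \<and> ord_ge (- n) (v $ i))" for i
  have "n i \<ge> 0 \<and> ord_ge (- n i) (v $ i)" for i
    unfolding n_def by (rule someI_ex) (rule ord_ge_exists)
  hence n: "n i \<ge> 0" "ord_ge (- n i) (v $ i)" for i by simp_all
  have le: "n i \<le> sum n UNIV" for i by (rule member_le_sum) (simp_all add: n(1))
  have "ord_ge (- sum n UNIV) (v $ i)" for i
    by (rule ord_ge_mono[OF n(2)]) (simp add: le)
  moreover have "sum n UNIV \<ge> 0" by (rule sum_nonneg) (simp add: n(1))
  ultimately show ?thesis unfolding vec_ord_ge_def by (intro exI[of _ "sum n UNIV"] conjI allI)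
qed

lemma vec_coeff_0 [simp]: "vec_coeff 0 n = 0" by (simp add: vec_coeff_def vec_eq_iff)
lemma vec_coeff_add: "vec_coeff (v + w) n = vec_coeff v n + vec_coeff w n" by (simp add: vec_coeff_def vec_eq_iff)
lemma vec_coeff_diff: "vec_coeff (v - w) n = vec_coeff v n - vec_coeff w n" by (simp add: vec_coeff_def vec_eq_iff)
lemma vec_coeff_const: "vec_coeff (fls_const c *s v) n = c *s vec_coeff v n" by (simp add: vec_coeff_def vec_eq_iff)
lemma vec_coeff_eqI: "(\<And>n. vec_coeff v n = vec_coeff w n) \<Longrightarrow> v = w"
  by (simp add: vec_coeff_def vec_eq_iff fls_eq_iff)

text \<open>In the lowest possible degree the Cauchy product has a single term. The bounds need not
  be attained; otherwise both sides are 0.\<close>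

lemma vec_coeff_leading_scale:
  assumes "ord_ge a c" "vec_ord_ge b v"
  shows "vec_coeff (c *s v) (a + b) = fls_nth c a *s vec_coeff v b"
proof -
  have "fls_nth (c * v $ i) (a + b) = fls_nth c a * fls_nth (v $ i) b" for i
  proof (cases "c = 0 \<or> v $ i = 0")
    case False
    have le: "a \<le> fls_subdegree c" "b \<le> fls_subdegree (v $ i)"
      using assms False by (auto simp: vec_ord_ge_def ord_ge_iff)
    show ?thesis
    proof (cases "a = fls_subdegree c \<and> b = fls_subdegree (v $ i)")
      case True
      thus ?thesis by (simp add: fls_times_base)
    next
      case False2: False
      hence "a + b < fls_subdegree c + fls_subdegree (v $ i)" using le by auto
      moreover have "a < fls_subdegree c \<or> b < fls_subdegree (v $ i)" using False2 le by auto
      ultimately show ?thesis by (auto simp: fls_times_nth_eq0)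
    qed
  qed auto
  thus ?thesis by (simp add: vec_coeff_def vec_eq_iff)
qed

text \<open>Both y' and y/t lower the exponent by one. So coefficient 0 of \<open>v\<close> is the
  one that produces the residue, at index -1, and there the operator is \<open>R\<close>
  alone.\<close>

lemma vec_coeff_fuchsian_nabla:
  "vec_coeff (fuchsian_nabla R v) (n - 1) = of_int n *s vec_coeff v n + R *v vec_coeff v n"
  by (simp add: vec_coeff_def fuchsian_nabla_def vec_eq_iff matrix_vector_mult_def fls_X_inv_times_conv_shift
      fls_nth_sum)

lemma fuchsian_nabla_diff: "fuchsian_nabla R (v - w) = fuchsian_nabla R v - fuchsian_nabla R w"
  by (simp add: fuchsian_nabla_def vec_eq_iff matrix_vector_mult_diff_distrib algebra_simps)

text \<open>If \<open>y\<close> had a pole, its derivative would have a pole of larger order than \<open>B y\<close>.\<close>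

lemma linear_ode_solution_holomorphic:
  fixes y :: "complex fls ^ 'm" and B :: "complex fls ^ 'm ^ 'm"
  assumes B: "\<And>i j. ord_ge 0 (B $ i $ j)" and ode: "\<And>i. fls_deriv (y $ i) = (B *v y) $ i"
  shows "vec_ord_ge 0 y"
proof -
  have step: "vec_ord_ge (n + 1) y" if n: "vec_ord_ge n y" "n < 0" for n
  proof -
    have "fls_nth (y $ i) n = 0" for i
    proof -
      have "vec_ord_ge n (B *v y)" using B n(1) by (rule vec_ord_ge_matrix) auto
      hence "fls_nth (fls_deriv (y $ i)) (n - 1) = 0" unfolding ode by (auto simp: vec_ord_ge_def ord_ge_def)
      thus ?thesis using n(2) by simp
    qed
    thus ?thesis using n(1) by (auto simp: vec_ord_ge_def ord_ge_def) (metis order_le_less)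
  qed
  obtain n where n: "n \<ge> 0" "vec_ord_ge (- n) y" using vec_ord_ge_exists by blast
  have "vec_ord_ge (min 0 (int k - n)) y" for k
  proof (induction k)
    case 0 thus ?case using n by simp
  next
    case (Suc k)
    show ?case
    proof (cases "int k - n < 0")
      case True
      hence "min 0 (int k - n) = int k - n" "min 0 (int (Suc k) - n) = int k - n + 1" by auto
      thus ?thesis using step[of "int k - n"] Suc True by (simp add: algebra_simps)
    qed (use Suc in simp)
  qed
  from this[of "nat n"] n show ?thesis by simp
qed

lemma meromorphic_germ_sum:
  "(\<And>i. i \<in> I \<Longrightarrow> meromorphic_germ (f i)) \<Longrightarrow> meromorphic_germ (\<Sum>i\<in>I. f i)"
proof (induction I rule: infinite_finite_induct)
  case (insert x I)
  hence "0 < min (fls_conv_radius (f x)) (fls_conv_radius (\<Sum>i\<in>I. f i))"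
    by (simp add: meromorphic_germ_def)
  also have "\<dots> \<le> fls_conv_radius (f x + (\<Sum>i\<in>I. f i))" by (rule fls_conv_radius_add)
  finally show ?case using insert by (simp add: meromorphic_germ_def)
qed (simp_all add: meromorphic_germ_def)

lemma meromorphic_germ_mult_const: "meromorphic_germ f \<Longrightarrow> meromorphic_germ (f * fls_const c)"
  using fls_conv_radius_mult[of f "fls_const c"] by (simp add: meromorphic_germ_def)

lemma linear_coefficient_operator:
  "Vector_Spaces.linear (*s) (*s) (\<lambda>u :: complex ^ 'm. c *s u + M *v u)"
proof -
  have "(\<lambda>u :: complex ^ 'm. c *s u + M *v u) = (*v) (mat c + M)"
    by (rule ext) (simp add: matrix_vector_mult_add_rdistrib matrix_vector_mult_def mat_def vec_eq_iff
        distrib_right sum.distrib if_distrib[of "\<lambda>x. x * _"] cong: if_cong)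
  thus ?thesis by simp
qed

definition expand :: "proj_point \<Rightarrow> complex poly fract ^ 'm \<Rightarrow> complex fls ^ 'm" where
  "expand P f = (\<chi> i. ratfun_at P (f $ i))"

abbreviation dz :: "proj_point \<Rightarrow> complex fls" where
  "dz P \<equiv> fls_deriv (coord_at P)"

text \<open>The order of the form dz: at infinity dz = -dt/t^2.\<close>

definition val_dz :: "proj_point \<Rightarrow> int" where
  "val_dz P = (if P = Infinity then -2 else 0)"

lemma subdegree_dz: "fls_subdegree (dz P) = val_dz P"
proof (cases P)
  case Infinity
  have "fls_deriv (fls_X_inv :: complex fls) = - fls_X_intpow (- 2)"
    by (rule fls_eqI) auto
  thus ?thesis using Infinity by (simp add: val_dz_def)
qed (simp add: val_dz_def)

lemma expand_add: "expand P (f + g) = expand P f + expand P g"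
  by (simp add: expand_def vec_eq_iff ratfun_at_add)
lemma expand_scale: "expand P (c *s f) = ratfun_at P c *s expand P f"
  by (simp add: expand_def vec_eq_iff ratfun_at_mult)
lemma expand_eq_0_iff [simp]: "expand P f = 0 \<longleftrightarrow> f = 0"
  by (simp add: expand_def vec_eq_iff)

lemma expand_0 [simp]: "expand P 0 = 0"
  by simp

lemma form_at_eq: "form_at P w = dz P *s expand P w"
  by (simp add: form_at_def expand_def vec_eq_iff mult.commute)

lemma nabla_at_expand: "nabla_at A P (expand P f) = form_at P (nabla A f)"
proof (simp add: vec_eq_iff, rule allI)
  fix i
  show "nabla_at A P (expand P f) $ i = form_at P (nabla A f) $ i"
    by (simp add: nabla_at_def form_at_def expand_def nabla_def matrix_at_def matrix_vector_mult_def
        ratfun_at_deriv ratfun_at_add ratfun_at_sum ratfun_at_mult distrib_left sum_distrib_left mult_ac)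
qed

lemma nabla_add: "nabla A (f + g) = nabla A f + nabla A g"
  by (simp add: nabla_def vec_eq_iff ratfun_deriv_add matrix_vector_right_distrib)

lemma matrix_vector_mult_axis:
  fixes M :: "'a::comm_ring_1 ^ 'n ^ 'k"
  shows "M *v axis j 1 = column j M"
  by (simp add: matrix_vector_mult_def column_def axis_def vec_eq_iff if_distrib cong: if_cong)

text \<open>Witnesses of \<open>regular_singular\<close>, chosen at every point, with
  \<open>H P\<close> as a name for the inverse gauge. No relation between different points is
  assumed; that the lattices fit together to a bundle is recovered in
  \<open>gauge_bounds\<close>.\<close>

locale fuchsian_connection =
  fixes A :: "complex poly fract ^ 'm ^ 'm" and S :: "proj_point set"
    and R :: "proj_point \<Rightarrow> complex ^ 'm ^ 'm"
    and G H :: "proj_point \<Rightarrow> complex fls ^ 'm ^ 'm"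
  assumes finite_S: "finite S"
    and GH: "G P ** H P = mat 1" and HG: "H P ** G P = mat 1"
    and germ: "meromorphic_germ (G P $ i $ j)"
    and gauge: "nabla_at A P (G P *v v) = G P *v fuchsian_nabla (R P) v"
    and eigenvalue: "u \<noteq> 0 \<Longrightarrow> R P *v u = ev *s u \<Longrightarrow> 0 \<le> Re ev \<and> Re ev < 1"
    and regular: "P \<notin> S \<Longrightarrow> R P = 0"
begin

lemma GHv [simp]: "G P *v (H P *v v) = v" "H P *v (G P *v v) = v"
  by (simp_all add: matrix_vector_mul_assoc GH HG)

text \<open>Otherwise \<open>- n\<close> would be an eigenvalue of \<open>R P\<close>, but 0 is the
  only integer in [0, 1).\<close>

lemma coefficient_injective:
  assumes "n \<noteq> 0" "of_int n *s u + R P *v u = 0"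
  shows "u = 0"
proof (rule ccontr)
  assume u: "u \<noteq> 0"
  have "R P *v u = (- of_int n) *s u" using assms(2)
    by (metis add.inverse_inverse add_eq_0_iff vector_smult_lneg)
  hence "0 \<le> Re (- of_int n) \<and> Re (- of_int n :: complex) < 1" using eigenvalue[OF u] by blast
  hence "n \<le> 0" "- n < 1" by auto
  thus False using assms(1) by linarith
qed

lemma coefficient_surjective:
  assumes "n \<noteq> 0 \<or> inj ((*v) (R P))"
  shows "\<exists>u. of_int n *s u + R P *v u = c"
proof -
  let ?f = "\<lambda>u. of_int n *s u + R P *v u"
  have "inj ?f"
  proof (cases "n = 0")
    case False
    thus ?thesis unfolding vec.linear_inj_iff_eq_0[OF linear_coefficient_operator]
      using coefficient_injective[OF False] by blast
  next
    case True
    thus ?thesis using assms by simp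
  qed
  hence "surj ?f" by (rule vec.linear_injective_imp_surjective[OF linear_coefficient_operator _ refl])
  then obtain u where "c = ?f u" unfolding surj_def by blast
  thus ?thesis by (intro exI[of _ u]) (rule sym)
qed

text \<open>The coordinates of \<open>f\<close> with respect to the columns of the gauge matrix \<open>G P\<close>: the lattice
  \<open>\<Lambda>\<^sub>P = G P \<cdot> O\<^sub>P\<^sup>m\<close> consists of the vectors with holomorphic coordinates.\<close>

definition loc :: "proj_point \<Rightarrow> complex poly fract ^ 'm \<Rightarrow> complex fls ^ 'm" where
  "loc P f = H P *v expand P f"

lemma loc_add: "loc P (f + g) = loc P f + loc P g"
  by (simp add: loc_def expand_add matrix_vector_right_distrib)
lemma loc_scale: "loc P (c *s f) = ratfun_at P c *s loc P f"
  by (simp add: loc_def expand_scale vec.scale)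
lemma loc_const: "loc P (to_fract [:c:] *s f) = fls_const c *s loc P f"
  by (simp only: loc_scale ratfun_at_const)
lemma loc_0 [simp]: "loc P 0 = 0"
  by (simp add: loc_def)
lemma loc_diff: "loc P (f - g) = loc P f - loc P g"
  using loc_add[of P "f - g" g] by simp
lemma loc_eq_0_iff [simp]: "loc P f = 0 \<longleftrightarrow> f = 0"
proof
  assume "loc P f = 0"
  hence "G P *v loc P f = 0" by simp
  thus "f = 0" by (simp add: loc_def)
qed simp

lemma loc_nabla: "dz P *s loc P (nabla A f) = fuchsian_nabla (R P) (loc P f)"
proof -
  have "G P *v (dz P *s loc P (nabla A f)) = nabla_at A P (expand P f)"
    by (simp add: nabla_at_expand form_at_eq loc_def flip: vec.scale)
  also have "\<dots> = G P *v fuchsian_nabla (R P) (loc P f)"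
    using gauge[of P "loc P f"] by (simp add: loc_def)
  finally show ?thesis by (metis GHv(2))
qed

text \<open>In gauge coordinates a solution \<open>v\<close> has only coefficient 0, since n +
  \<open>R P\<close> is injective for all other n; so it is a constant vector in the kernel of
  \<open>R P\<close>. Conversely \<open>G P\<close> times such a vector is meromorphic because the
  entries of \<open>G P\<close> are germs.\<close>

lemma t0_eq: "t0 A P = vec.dim {u. R P *v u = 0}"
proof -
  define Z where "Z = {u. R P *v u = 0}"
  define T where "T = (\<lambda>u. G P *v (\<chi> i. fls_const (u $ i)))"
  have solution_iff: "nabla_at A P (G P *v v) = 0 \<longleftrightarrow> (\<exists>u\<in>Z. v = (\<chi> i. fls_const (u $ i)))" for v
  proof -
    have "nabla_at A P (G P *v v) = 0 \<longleftrightarrow> fuchsian_nabla (R P) v = 0"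
      unfolding gauge by (metis GHv(2) matrix_vector_mult_0_right)
    also have "\<dots> \<longleftrightarrow> (\<forall>n. of_int n *s vec_coeff v n + R P *v vec_coeff v n = 0)"
    proof
      assume "fuchsian_nabla (R P) v = 0"
      thus "\<forall>n. of_int n *s vec_coeff v n + R P *v vec_coeff v n = 0"
        by (simp flip: vec_coeff_fuchsian_nabla)
    next
      assume *: "\<forall>n. of_int n *s vec_coeff v n + R P *v vec_coeff v n = 0"
      show "fuchsian_nabla (R P) v = 0"
      proof (rule vec_coeff_eqI)
        fix n show "vec_coeff (fuchsian_nabla (R P) v) n = vec_coeff 0 n"
          using *[rule_format, of "n + 1"] vec_coeff_fuchsian_nabla[of "R P" v "n + 1"] by simp
      qed
    qed
    also have "\<dots> \<longleftrightarrow> (\<forall>n. n \<noteq> 0 \<longrightarrow> vec_coeff v n = 0) \<and> R P *v vec_coeff v 0 = 0"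
      (is "?l \<longleftrightarrow> ?r")
    proof
      assume l: ?l
      have "vec_coeff v n = 0" if "n \<noteq> 0" for n using coefficient_injective[OF that l[rule_format]] .
      thus ?r using l[rule_format, of 0] by simp
    next
      assume r: ?r
      show ?l
      proof
        fix n show "of_int n *s vec_coeff v n + R P *v vec_coeff v n = 0" using r by (cases "n = 0") simp_all
      qed
    qed
    also have "\<dots> \<longleftrightarrow> (\<exists>u\<in>Z. v = (\<chi> i. fls_const (u $ i)))"
    proof
      assume *: "(\<forall>n. n \<noteq> 0 \<longrightarrow> vec_coeff v n = 0) \<and> R P *v vec_coeff v 0 = 0"
      have "v = (\<chi> i. fls_const (vec_coeff v 0 $ i))"
      proof (rule vec_coeff_eqI)
        fix n show "vec_coeff v n = vec_coeff (\<chi> i. fls_const (vec_coeff v 0 $ i)) n"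
          using * by (cases "n = 0") (auto simp: vec_coeff_def vec_eq_iff)
      qed
      thus "\<exists>u\<in>Z. v = (\<chi> i. fls_const (u $ i))" using * by (auto simp: Z_def)
    next
      assume "\<exists>u\<in>Z. v = (\<chi> i. fls_const (u $ i))"
      thus "(\<forall>n. n \<noteq> 0 \<longrightarrow> vec_coeff v n = 0) \<and> R P *v vec_coeff v 0 = 0"
        by (auto simp: vec_coeff_def Z_def vec_eq_iff)
    qed
    finally show ?thesis .
  qed
  have "vec.subspace Z" unfolding Z_def
    by (auto simp: vec.subspace_def matrix_vector_right_distrib vec.scale)
  hence d: "has_dim (*s) Z (vec.dim Z)" by (rule vec_has_dim)
  have bij: "bij_betw T Z (carrier (local_solutions A P))"
  proof (rule bij_betwI')
    fix u u' show "(T u = T u') = (u = u')"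
    proof
      assume "T u = T u'"
      hence "H P *v T u = H P *v T u'" by simp
      hence "fls_nth (fls_const (u $ i)) 0 = fls_nth (fls_const (u' $ i)) 0" for i
        by (simp add: T_def vec_eq_iff)
      thus "u = u'" by (simp add: vec_eq_iff)
    qed simp
  next
    fix u assume u: "u \<in> Z"
    have "meromorphic_germ (T u $ i)" for i
      unfolding T_def matrix_vector_mult_def
      by (auto intro!: meromorphic_germ_sum meromorphic_germ_mult_const germ)
    moreover have "nabla_at A P (T u) = 0" unfolding T_def using solution_iff u by blast
    ultimately show "T u \<in> carrier (local_solutions A P)"
      by (simp add: local_solutions_def)
  next
    fix y assume "y \<in> carrier (local_solutions A P)"
    hence "nabla_at A P (G P *v (H P *v y)) = 0" by (simp add: local_solutions_def)
    then obtain u where "u \<in> Z" "H P *v y = (\<chi> i. fls_const (u $ i))" using solution_iff by blast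
    thus "\<exists>u\<in>Z. y = T u" unfolding T_def by (metis GHv(1))
  qed
  have "vectorspace.fin_dim complex_field (local_solutions A P) \<and>
    vectorspace.dim complex_field (local_solutions A P) = vec.dim Z"
  proof (rule vectorspace_dim_eqI[OF _ d bij])
    show "vector_space ((*s) :: complex \<Rightarrow> complex ^ 'm \<Rightarrow> _)" by unfold_locales
    have *: "(\<chi> i. fls_const (x i + y i)) = (\<chi> i. fls_const (x i)) + (\<chi> i::'m. fls_const (y i :: complex))" for x y
      by (simp add: vec_eq_iff fls_plus_const)
    have **: "(\<chi> i. fls_const (c * x i)) = fls_const c *s (\<chi> i::'m. fls_const (x i :: complex))" for x c
      by (simp add: vec_eq_iff)
    show "T 0 = \<zero>\<^bsub>local_solutions A P\<^esub>"
      by (simp add: T_def local_solutions_def local_vectors_def type_space_def matrix_vector_mult_def vec_eq_iff)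
    show "T (x + y) = T x \<oplus>\<^bsub>local_solutions A P\<^esub> T y" for x y
      by (simp add: T_def local_solutions_def local_vectors_def type_space_def * matrix_vector_right_distrib)
    show "T (c *s x) = c \<odot>\<^bsub>local_solutions A P\<^esub> T x" for c x
      by (simp add: T_def local_solutions_def local_vectors_def type_space_def ** vec.scale)
  qed
  thus ?thesis by (simp add: t0_def Z_def)
qed

lemma injective_of_t0: "t0 A P = 0 \<Longrightarrow> inj ((*v) (R P))"
proof -
  assume "t0 A P = 0"
  hence "{u. R P *v u = 0} \<subseteq> {0}" by (simp add: t0_eq)
  thus ?thesis by (auto simp: vec.linear_inj_iff_eq_0[OF matrix_vector_mul_linear_gen])
qed

text \<open>The columns of \<open>G P\<close> and the rows of its inverse solve linear equations with holomorphic
  coefficients.\<close>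

lemma gauge_holomorphic:
  assumes "P \<notin> S" and A: "\<And>i j. ord_ge 0 (matrix_at P A $ i $ j)"
  shows "ord_ge 0 (G P $ i $ j)" "ord_ge 0 (H P $ i $ j)"
proof -
  have R0: "fuchsian_nabla (R P) v = (\<chi> i. fls_deriv (v $ i))" for v
  proof -
    have "(\<chi> i j. fls_const ((0 :: complex ^ 'm ^ 'm) $ i $ j)) *v v = 0"
      by (simp add: matrix_vector_mult_def vec_eq_iff)
    thus ?thesis using assms(1) by (simp add: fuchsian_nabla_def regular)
  qed
  have "vec_ord_ge 0 (column j (G P))"
  proof (rule linear_ode_solution_holomorphic)
    show "ord_ge 0 ((- matrix_at P A) $ i $ j)" for i j
      using A[of i j] by (simp add: ord_ge_def)
    have "nabla_at A P (G P *v axis j 1) = G P *v (\<chi> i. fls_deriv (axis j 1 $ i))"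
      using gauge[of P "axis j 1"] by (simp only: R0)
    also have "(\<chi> i. fls_deriv (axis j 1 $ i)) = (0 :: complex fls ^ 'm)"
      by (simp add: vec_eq_iff axis_def)
    finally have "(\<chi> i. fls_deriv (column j (G P) $ i)) + matrix_at P A *v column j (G P) = 0"
      by (simp add: nabla_at_def matrix_vector_mult_axis)
    thus "fls_deriv (column j (G P) $ i) = (- matrix_at P A *v column j (G P)) $ i" for i
      by (simp add: vec_eq_iff add_eq_0_iff2 matrix_vector_mult_def sum_negf)
  qed
  thus "ord_ge 0 (G P $ i $ j)" by (simp add: vec_ord_ge_def column_def)
  have "vec_ord_ge 0 (H P $ i)"
  proof (rule linear_ode_solution_holomorphic)
    show "ord_ge 0 (transpose (matrix_at P A) $ i $ j)" for i j
      using A[of j i] by (simp add: transpose_def)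
    fix j
    \<comment> \<open>Applying the gauge equation to constant vectors gives H' = H A, so each row of
      \<open>H P\<close> solves the system with the transposed matrix.\<close>
    have "matrix_at P A *v axis j 1 = nabla_at A P (G P *v (H P *v axis j 1))"
      by (simp add: nabla_at_def vec_eq_iff axis_def)
    also have "\<dots> = G P *v (\<chi> i. fls_deriv ((H P *v axis j 1) $ i))"
      by (simp only: gauge R0)
    finally have "H P *v (matrix_at P A *v axis j 1) = (\<chi> i. fls_deriv ((H P *v axis j 1) $ i))"
      by simp
    thus "fls_deriv (H P $ i $ j) = (transpose (matrix_at P A) *v (H P $ i)) $ j"
      by (simp add: vec_eq_iff matrix_vector_mult_axis column_def)
         (simp add: matrix_vector_mult_def vector_matrix_mult_def column_def mult.commute)
  qed
  thus "ord_ge 0 (H P $ i $ j)" by (simp add: vec_ord_ge_def)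
qed

text \<open>At almost all points the gauge and its inverse are holomorphic, so the lattice there is
  the standard one; the finitely many other points admit some pole bound. This is the only global
  information on the gauges, and it makes the lattices a vector bundle.\<close>

lemma gauge_bounds:
  obtains k :: "proj_point \<Rightarrow> int" where "finite {P. k P \<noteq> 0}" "\<And>P. k P \<ge> 0"
    "\<And>P i j. ord_ge (- k P) (G P $ i $ j)" "\<And>P i j. ord_ge (- k P) (H P $ i $ j)"
proof -
  \<comment> \<open>Infinity is included because the double pole of dz can give the local matrix
    poles that the entries of \<open>A\<close> do not have.\<close>
  define B where "B = S \<union> {Infinity} \<union> (\<Union>i. \<Union>j. {P. val P (A $ i $ j) \<noteq> 0})"
  have fB: "finite B" unfolding B_def using finite_S finite_val_nonzero by auto
  have good: "ord_ge 0 (G P $ i $ j)" "ord_ge 0 (H P $ i $ j)" if P: "P \<notin> B" for P i j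
  proof -
    have "ord_ge 0 (matrix_at P A $ i $ j)" for i j
    proof -
      obtain a where a: "P = Finite a" using P by (cases P) (auto simp: B_def)
      have "val P (A $ i $ j) = 0" using P by (auto simp: B_def)
      hence "ord_ge 0 (ratfun_at P (A $ i $ j))" by (simp add: ord_ge_ratfun_iff)
      thus ?thesis by (simp add: matrix_at_def a)
    qed
    moreover have "P \<notin> S" using P by (simp add: B_def)
    ultimately show "ord_ge 0 (G P $ i $ j)" "ord_ge 0 (H P $ i $ j)" using gauge_holomorphic by blast+
  qed
  have "\<exists>n\<ge>0. \<forall>i j. ord_ge (- n) (M $ i $ j)" for M :: "complex fls ^ 'm ^ 'm"
  proof -
    define n where "n i = (SOME n. n \<ge> 0 \<and> vec_ord_ge (- n) (M $ i))" for i
    have "n i \<ge> 0 \<and> vec_ord_ge (- n i) (M $ i)" for i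
      unfolding n_def by (rule someI_ex) (rule vec_ord_ge_exists)
    hence n: "n i \<ge> 0" "vec_ord_ge (- n i) (M $ i)" for i by simp_all
    have le: "n i \<le> sum n UNIV" for i by (rule member_le_sum) (simp_all add: n(1))
    have "vec_ord_ge (- sum n UNIV) (M $ i)" for i
      by (rule vec_ord_ge_mono[OF n(2)]) (simp add: le)
    moreover have "sum n UNIV \<ge> 0" by (rule sum_nonneg) (simp add: n(1))
    ultimately show ?thesis unfolding vec_ord_ge_def by (intro exI[of _ "sum n UNIV"] conjI allI) auto
  qed
  then obtain n where n: "\<And>M :: complex fls ^ 'm ^ 'm. n M \<ge> 0"
    "\<And>(M :: complex fls ^ 'm ^ 'm) i j. ord_ge (- n M) (M $ i $ j)" by metis
  define k where "k P = (if P \<in> B then max (n (G P)) (n (H P)) else 0)" for P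
  show ?thesis
  proof (rule that)
    show "finite {P. k P \<noteq> 0}" by (rule finite_subset[OF _ fB]) (auto simp: k_def)
    show "k P \<ge> 0" for P using n(1) by (auto simp: k_def max_def)
    show "ord_ge (- k P) (G P $ i $ j)" for P i j
      using good n(2)[of "G P" i j] by (auto simp: k_def intro: ord_ge_mono)
    show "ord_ge (- k P) (H P $ i $ j)" for P i j
      using good n(2)[of "H P" i j] by (auto simp: k_def intro: ord_ge_mono)
  qed
qed

text \<open>The standard coordinates \<open>G P *v v P\<close> are approximated entry by entry.
  Returning to gauge coordinates by \<open>H P\<close> loses up to \<open>k P\<close> orders, so
  points with nonzero \<open>k P\<close> outside \<open>T\<close> must be controlled too: there the
  target is 0.\<close>

lemma loc_approximation:
  assumes "finite T" "P0 \<notin> T"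
  shows "\<exists>f. (\<forall>P\<in>T. vec_ord_ge N (loc P f - v P)) \<and> (\<forall>P. P \<notin> T \<and> P \<noteq> P0 \<longrightarrow> vec_ord_ge 0 (loc P f))"
proof -
  obtain k where k: "finite {P. k P \<noteq> 0}" "\<And>P. k P \<ge> 0"
    "\<And>P i j. ord_ge (- k P) (G P $ i $ j)" "\<And>P i j. ord_ge (- k P) (H P $ i $ j)"
    by (rule gauge_bounds) blast
  define T' where "T' = (T \<union> {P. k P \<noteq> 0}) - {P0}"
  define v' where "v' P = (if P \<in> T then v P else 0)" for P
  \<comment> \<open>The sum compensates the loss at every point of \<open>T'\<close> at once, and
    the maximum with 0 leaves holomorphic coordinates at the points added to
    \<open>T\<close>.\<close>
  define N' where "N' = max N 0 + (\<Sum>P\<in>T'. k P)"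
  have T': "finite T'" "P0 \<notin> T'" using assms k(1) by (auto simp: T'_def)
  have kN: "N \<le> N' - k P \<and> 0 \<le> N' - k P" if "P \<in> T'" for P
    using member_le_sum[of P T' k] k(2) T'(1) that by (auto simp: N'_def)
  have "\<exists>f. (\<forall>P\<in>T'. ord_ge N' (ratfun_at P f - (G P *v v' P) $ i)) \<and>
    (\<forall>Q. Q \<notin> T' \<and> Q \<noteq> P0 \<longrightarrow> ord_ge 0 (ratfun_at Q f))" for i
    using approximation[OF T'] .
  then obtain F where F: "\<And>i P. P \<in> T' \<Longrightarrow> ord_ge N' (ratfun_at P (F i) - (G P *v v' P) $ i)"
    "\<And>i Q. Q \<notin> T' \<Longrightarrow> Q \<noteq> P0 \<Longrightarrow> ord_ge 0 (ratfun_at Q (F i))" by metis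
  define f where "f = (\<chi> i. F i)"
  have near: "vec_ord_ge (N' - k P) (loc P f - v' P)" if "P \<in> T'" for P
  proof -
    have "loc P f - v' P = H P *v (expand P f - G P *v v' P)"
      by (simp add: loc_def matrix_vector_mult_diff_distrib)
    moreover have "vec_ord_ge N' (expand P f - G P *v v' P)" using F(1)[OF that]
      by (simp add: vec_ord_ge_def expand_def f_def)
    ultimately show ?thesis using vec_ord_ge_matrix[OF k(4)] by simp
  qed
  show ?thesis
  proof (intro exI[of _ f] conjI ballI allI impI)
    fix P assume P: "P \<in> T"
    hence "P \<in> T'" using assms by (auto simp: T'_def)
    thus "vec_ord_ge N (loc P f - v P)" using near[of P] kN[of P] P by (auto simp: v'_def elim: vec_ord_ge_mono)
  next
    fix P assume P: "P \<notin> T \<and> P \<noteq> P0"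
    show "vec_ord_ge 0 (loc P f)"
    proof (cases "P \<in> T'")
      case True
      thus ?thesis using near[of P] kN[of P] P by (auto simp: v'_def elim: vec_ord_ge_mono)
    next
      case False
      hence "k P = 0" using P by (auto simp: T'_def)
      moreover have "vec_ord_ge 0 (expand P f)" using F(2)[OF False] P by (simp add: vec_ord_ge_def expand_def f_def)
      ultimately show ?thesis unfolding loc_def using k(4)[of P] by (intro vec_ord_ge_matrix[of 0]) auto
    qed
  qed
qed

lemma finite_loc_nonholomorphic: "finite {P. \<not> vec_ord_ge 0 (loc P f)}"
proof -
  obtain k where k: "finite {P. k P \<noteq> 0}" "\<And>P. k P \<ge> 0"
    "\<And>P i j. ord_ge (- k P) (G P $ i $ j)" "\<And>P i j. ord_ge (- k P) (H P $ i $ j)"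
    by (rule gauge_bounds) blast
  have "vec_ord_ge 0 (loc P f)" if "k P = 0" "\<And>i. val P (f $ i) = 0" for P
    unfolding loc_def using k(4)[of P] that
    by (intro vec_ord_ge_matrix[of 0 _ 0]) (auto simp: vec_ord_ge_def expand_def ord_ge_ratfun_iff)
  hence "{P. \<not> vec_ord_ge 0 (loc P f)} \<subseteq> {P. k P \<noteq> 0} \<union> (\<Union>i. {P. val P (f $ i) \<noteq> 0})" by blast
  thus ?thesis by (rule finite_subset) (use k(1) finite_val_nonzero in auto)
qed

end

section \<open>Global sections and their dimensions\<close>

definition gscale :: "complex \<Rightarrow> complex poly fract ^ 'm \<Rightarrow> complex poly fract ^ 'm" where
  "gscale c w = to_fract [:c:] *s w"

lemma to_fract_const_add: "to_fract [:a + b :: complex:] = to_fract [:a:] + to_fract [:b:]"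
  by (simp flip: to_fract_add)

lemma to_fract_const_mult: "to_fract [:a * b :: complex:] = to_fract [:a:] * to_fract [:b:]"
  by (simp flip: to_fract_mult)

lemma vector_space_gscale: "vector_space gscale"
  by unfold_locales
     (simp_all add: gscale_def vector_add_ldistrib vector_sadd_rdistrib to_fract_const_add to_fract_const_mult
        vector_smult_assoc flip: one_pCons)

interpretation gs: vector_space gscale
  by (rule vector_space_gscale)

lemma vector_space_vec: "vector_space ((*s) :: complex \<Rightarrow> complex ^ 'm \<Rightarrow> _)"
  by unfold_locales

lemma ratfun_deriv_const_mult: "ratfun_deriv (to_fract [:c:] * f) = to_fract [:c:] * ratfun_deriv f"
proof -
  let ?P = "Finite 0"
  have "ratfun_at ?P (ratfun_deriv (to_fract [:c:] * f)) * dz ?P = ratfun_at ?P (to_fract [:c:] * ratfun_deriv f) * dz ?P"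
    by (simp only: ratfun_at_deriv[symmetric] ratfun_at_mult ratfun_at_const fls_deriv_mult_const_left mult.assoc)
  hence "ratfun_at ?P (ratfun_deriv (to_fract [:c:] * f) - to_fract [:c:] * ratfun_deriv f) = 0"
    using fls_deriv_coord_at_nonzero[of ?P] by (simp add: ratfun_at_diff del: coord_at.simps)
  thus ?thesis by simp
qed

lemma nabla_gscale: "nabla A (gscale c f) = gscale c (nabla A f)"
  by (simp add: nabla_def gscale_def vec_eq_iff ratfun_deriv_const_mult vec.scale distrib_left)

lemma linear_nabla: "Vector_Spaces.linear gscale gscale (nabla A)"
  by (simp add: Vector_Spaces.linear_iff vector_space_gscale nabla_add nabla_gscale)

lemma nabla_diff: "nabla A (f - g) = nabla A f - nabla A g"
  using nabla_add[of A "f - g" g] by simp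

lemma linear_scale: "Vector_Spaces.linear gscale gscale (\<lambda>f. h *s f)"
  by (simp add: Vector_Spaces.linear_iff vector_space_gscale gscale_def vector_add_ldistrib vector_smult_assoc mult.commute)

lemma vec_subspace_axis:
  assumes "vec.subspace (X :: ('a::field ^ 'n) set)" "\<And>i. axis i 1 \<in> X"
  shows "X = UNIV"
proof -
  have "c \<in> X" for c
  proof -
    have "(\<Sum>i\<in>UNIV. c $ i *s axis i 1) \<in> X"
      using assms by (intro vec.subspace_sum vec.subspace_scale) auto
    thus ?thesis by (simp add: basis_expansion)
  qed
  thus ?thesis by blast
qed

section \<open>Sections of the twisted bundles and the action of the connection on them\<close>

locale fuchsian_connection_at = fuchsian_connection A S R G H
  for A :: "complex poly fract ^ 'm ^ 'm" and S R G H +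
  fixes P0 :: proj_point
  assumes P0: "P0 \<in> S" and inj_R: "inj ((*v) (R P0))"
begin

text \<open>The global sections of \<open>M\<close> twisted by the divisor with multiplicity -
  \<open>\<delta> P\<close> at \<open>P\<close>.\<close>

definition sec :: "(proj_point \<Rightarrow> int) \<Rightarrow> (complex poly fract ^ 'm) set" where
  "sec \<delta> = {f. \<forall>P. vec_ord_ge (\<delta> P) (loc P f)}"

lemma subspace_sec: "gs.subspace (sec \<delta>)"
  unfolding gs.subspace_def
  by (auto simp: sec_def loc_add gscale_def loc_const intro!: vec_ord_ge_add vec_ord_ge_scale[OF ord_ge_const])

text \<open>The spaces \<open>\<Gamma>(M(n P0))\<close> and \<open>\<Gamma>(M(n P0) \<otimes> \<Omega>(S))\<close>, where \<open>M\<close> is the bundle with local lattices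
  \<open>\<Lambda>\<^sub>P\<close>.\<close>

definition Msec :: "int \<Rightarrow> (complex poly fract ^ 'm) set" where
  "Msec n = sec (\<lambda>P. if P = P0 then - n else 0)"

definition Esec :: "int \<Rightarrow> (complex poly fract ^ 'm) set" where
  "Esec n = sec (\<lambda>P. - val_dz P - of_bool (P \<in> S) - (if P = P0 then n else 0))"

lemma Msec_iff: "f \<in> Msec n \<longleftrightarrow> vec_ord_ge (- n) (loc P0 f) \<and> (\<forall>P. P \<noteq> P0 \<longrightarrow> vec_ord_ge 0 (loc P f))"
  by (auto simp: Msec_def sec_def)

text \<open>Multiplying by \<open>dz P\<close> passes from coefficients of dz to coefficients of dt,
  which absorbs the term \<open>val_dz P\<close>.\<close>

lemma Esec_iff: "w \<in> Esec n \<longleftrightarrow> (\<forall>P. vec_ord_ge (- of_bool (P \<in> S) - (if P = P0 then n else 0)) (dz P *s loc P w))"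
proof -
  have *: "- val_dz P - a - b = - a - b - val_dz P" for P a b by simp
  show ?thesis
    unfolding Esec_def sec_def mem_Collect_eq vec_ord_ge_scale_iff[OF fls_deriv_coord_at_nonzero] subdegree_dz * ..
qed

lemma Msec_mono: "n \<le> k \<Longrightarrow> Msec n \<subseteq> Msec k"
  by (rule subsetI) (simp add: Msec_iff vec_ord_ge_mono[of "- n" _ "- k"])

lemma Esec_mono: "n \<le> k \<Longrightarrow> Esec n \<subseteq> Esec k"
  unfolding Esec_iff subset_iff by (auto elim!: allE intro: vec_ord_ge_mono)

lemma subspace_Msec: "gs.subspace (Msec n)"
  unfolding Msec_def by (rule subspace_sec)

lemma subspace_Esec: "gs.subspace (Esec n)"
  unfolding Esec_def by (rule subspace_sec)

definition res :: "proj_point \<Rightarrow> complex poly fract ^ 'm \<Rightarrow> complex ^ 'm" where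
  "res P w = vec_coeff (dz P *s loc P w) (- 1)"

lemma res_add: "res P (v + w) = res P v + res P w"
  by (simp add: res_def loc_add vector_add_ldistrib vec_coeff_add)

lemma res_gscale: "res P (gscale c w) = c *s res P w"
proof -
  have "dz P *s (fls_const c *s v) = fls_const c *s (dz P *s v)" for v :: "complex fls ^ 'm"
    by (simp add: vec_eq_iff mult.left_commute)
  thus ?thesis by (simp only: res_def gscale_def loc_const vec_coeff_const)
qed

lemma linear_res: "Vector_Spaces.linear gscale (*s) (res P)"
  by (simp add: Vector_Spaces.linear_iff vector_space_gscale vector_space_vec res_add res_gscale)

lemma linear_coefficient: "Vector_Spaces.linear gscale (*s) (\<lambda>f. vec_coeff (loc P f) n)"
  by (simp add: Vector_Spaces.linear_iff vector_space_gscale vector_space_vec loc_add vec_coeff_add gscale_def loc_const vec_coeff_const)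

lemma res_nabla: "res P (nabla A f) = R P *v vec_coeff (loc P f) 0"
  using vec_coeff_fuchsian_nabla[of "R P" "loc P f" 0] by (simp add: res_def loc_nabla)

text \<open>Defined through residues so that it becomes a linear condition in finite-dimensional
  spaces; \<open>locally_exact_form_iff\<close> identifies it with exactness over all completions.
  Off \<open>S\<close>, where \<open>R P\<close> is 0, it says that the residue vanishes.\<close>

definition locally_exact :: "(complex poly fract ^ 'm) set" where
  "locally_exact = {w. \<forall>P. res P w \<in> range ((*v) (R P))}"

lemma subspace_locally_exact: "gs.subspace locally_exact"
  unfolding gs.subspace_def
proof (intro conjI ballI allI)
  have r: "vec.subspace (range ((*v) (R P)))" for P
    using vec.subspace_UNIV by (rule vec.subspace_image)
  show "0 \<in> locally_exact" using res_gscale[of _ 0 0] r by (auto simp: locally_exact_def vec.subspace_def gs.scale_zero_left)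
  show "x + y \<in> locally_exact" if "x \<in> locally_exact" "y \<in> locally_exact" for x y
    using that vec.subspace_add[OF r] by (auto simp only: locally_exact_def res_add mem_Collect_eq)
  show "gscale c x \<in> locally_exact" if "x \<in> locally_exact" for c x
    using that vec.subspace_scale[OF r] by (auto simp only: locally_exact_def res_gscale mem_Collect_eq)
qed

lemma nabla_in_locally_exact: "nabla A f \<in> locally_exact"
  by (auto simp: locally_exact_def res_nabla)

lemma coefficient_injective_P0:
  assumes "of_int n *s u + R P0 *v u = 0"
  shows "u = 0"
proof (cases "n = 0")
  case True
  hence "R P0 *v u = R P0 *v 0" using assms by simp
  thus ?thesis using inj_R by (meson injD)
qed (use coefficient_injective assms in blast)

text \<open>A global solution would expand to a formal solution at \<open>P0\<close>, where n +
  \<open>R P0\<close> is injective for every n, including 0.\<close>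

lemma nabla_eq_0_iff: "nabla A f = 0 \<longleftrightarrow> f = 0"
proof
  assume "nabla A f = 0"
  hence "fuchsian_nabla (R P0) (loc P0 f) = 0" using loc_nabla[of P0 f] by simp
  hence "of_int n *s vec_coeff (loc P0 f) n + R P0 *v vec_coeff (loc P0 f) n = 0" for n
    using vec_coeff_fuchsian_nabla[of "R P0" "loc P0 f" n] by simp
  hence "vec_coeff (loc P0 f) n = 0" for n using coefficient_injective_P0 by blast
  hence "loc P0 f = 0" by (intro vec_coeff_eqI) simp
  thus "f = 0" by simp
next
  show "f = 0 \<Longrightarrow> nabla A f = 0" using nabla_diff[of A 0 0] by simp
qed

text \<open>The operators n + \<open>R P\<close> can hide no pole: they are injective for n < 0, and
  at \<open>P0\<close> for all n. Conversely, applying the connection raises pole orders by at most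
  one, which is allowed on \<open>S\<close>; off \<open>S\<close> the only candidate, the residue,
  is \<open>R P\<close> applied to coefficient 0 and hence 0.\<close>

lemma nabla_in_Esec_iff: "nabla A f \<in> Esec n \<longleftrightarrow> f \<in> Msec n"
proof -
  let ?v = "\<lambda>P. loc P f" and ?d = "\<lambda>P. if P = P0 then - n else 0"
  have coeff: "vec_coeff (dz P *s loc P (nabla A f)) (j - 1) = of_int j *s vec_coeff (?v P) j + R P *v vec_coeff (?v P) j" for P j
    by (simp add: loc_nabla vec_coeff_fuchsian_nabla)
  have "vec_ord_ge (- of_bool (P \<in> S) - (if P = P0 then n else 0)) (dz P *s loc P (nabla A f)) \<longleftrightarrow> vec_ord_ge (?d P) (?v P)" for P
  proof
    assume *: "vec_ord_ge (- of_bool (P \<in> S) - (if P = P0 then n else 0)) (dz P *s loc P (nabla A f))"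
    show "vec_ord_ge (?d P) (?v P)"
      unfolding vec_ord_ge_iff_vec_coeff
    proof safe
      fix j assume j: "j < ?d P"
      hence "j - 1 < - of_bool (P \<in> S) - (if P = P0 then n else 0)" using P0 by (auto split: if_splits)
      hence "vec_coeff (dz P *s loc P (nabla A f)) (j - 1) = 0"
        using * unfolding vec_ord_ge_iff_vec_coeff by blast
      hence z: "of_int j *s vec_coeff (?v P) j + R P *v vec_coeff (?v P) j = 0" by (simp add: coeff)
      show "vec_coeff (?v P) j = 0"
      proof (cases "P = P0")
        case True thus ?thesis using z coefficient_injective_P0 by blast
      next
        case False
        hence "j \<noteq> 0" using j by simp
        thus ?thesis using z coefficient_injective[of j _ P] by blast
      qed
    qed
  next
    assume *: "vec_ord_ge (?d P) (?v P)"
    show "vec_ord_ge (- of_bool (P \<in> S) - (if P = P0 then n else 0)) (dz P *s loc P (nabla A f))"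
      unfolding vec_ord_ge_iff_vec_coeff
    proof safe
      fix k assume k: "k < - of_bool (P \<in> S) - (if P = P0 then n else 0)"
      show "vec_coeff (dz P *s loc P (nabla A f)) k = 0"
      proof (cases "P \<in> S")
        case True
        hence "k + 1 < ?d P" using k by (auto split: if_splits)
        hence "vec_coeff (?v P) (k + 1) = 0" using * unfolding vec_ord_ge_iff_vec_coeff by blast
        thus ?thesis using coeff[of P "k + 1"] by simp
      next
        case False
        hence "P \<noteq> P0" "R P = 0" using P0 regular by auto
        show ?thesis
        proof (cases "k = - 1")
          case True
          thus ?thesis using coeff[of P 0] \<open>R P = 0\<close> by simp
        next
          case False
          hence "k + 1 < ?d P" using k \<open>P \<notin> S\<close> \<open>P \<noteq> P0\<close> by auto
          hence "vec_coeff (?v P) (k + 1) = 0" using * unfolding vec_ord_ge_iff_vec_coeff by blast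
          thus ?thesis using coeff[of P "k + 1"] by simp
        qed
      qed
    qed
  qed
  thus ?thesis by (simp only: Esec_iff Msec_def sec_def mem_Collect_eq)
qed

lemma linear_inj_nabla: "inj_on (nabla A) X"
  by (rule inj_onI) (metis nabla_diff nabla_eq_0_iff right_minus_eq)

text \<open>The form \<open>h dz\<close> has divisor \<open>- (S - {P0}) + (card S - 3) P0\<close>, hence trivializes the twist by
  \<open>\<Omega>(S)\<close>.\<close>

lemma Esec_scaled_Msec:
  obtains h where "h \<noteq> 0" "\<And>n. Esec n = (\<lambda>f. h *s f) ` Msec (n + int (card S) - 2)"
proof -
  \<comment> \<open>The product has simple poles on \<open>S - {P0}\<close> and a zero of order card
    S - 1 at \<open>P0\<close>. The last factor moves the double pole of dz from infinity to
    \<open>P0\<close>, leaving order card S - 3 there.\<close>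
  define h where "h = (\<Prod>P\<in>S - {P0}. pole_zero P P0) * pole_zero Infinity P0 powi (- 2)"
  have h0: "h \<noteq> 0" using finite_S by (simp add: h_def)
  have vh: "val P h = (if P = P0 then int (card S) - 3 else - of_bool (P \<in> S)) - val_dz P" for P
  proof -
    have "val P (\<Prod>Q\<in>S - {P0}. pole_zero Q P0) = (\<Sum>Q\<in>S - {P0}. of_bool (P = P0) - of_bool (P = Q))"
      using finite_S by (subst val_prod) (auto simp: val_pole_zero)
    also have "\<dots> = (\<Sum>Q\<in>S - {P0}. of_bool (P = P0)) - (\<Sum>Q\<in>S - {P0}. if P = Q then 1 else 0)"
      unfolding sum_subtractf[symmetric] by (intro sum.cong) auto
    also have "\<dots> = of_bool (P = P0) * (int (card S) - 1) - of_bool (P \<in> S - {P0})"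
      using finite_S P0 card_gt_0_iff[of S] by (auto simp: card_Diff_singleton of_nat_diff Suc_leI)
    finally have 1: "val P (\<Prod>Q\<in>S - {P0}. pole_zero Q P0) = of_bool (P = P0) * (int (card S) - 1) - of_bool (P \<in> S - {P0})" .
    have 2: "val P (pole_zero Infinity P0 powi (- 2)) = - 2 * (of_bool (P = P0) - of_bool (P = Infinity))"
      by (simp only: val_powi pole_zero_nonzero val_pole_zero not_False_eq_True)
    have "val P h = of_bool (P = P0) * (int (card S) - 1) - of_bool (P \<in> S - {P0}) - 2 * (of_bool (P = P0) - of_bool (P = Infinity))"
      unfolding h_def using finite_S 1 2 by (subst val_mult) auto
    thus ?thesis by (auto simp: val_dz_def)
  qed
  have mem: "h *s f \<in> Esec n \<longleftrightarrow> f \<in> Msec (n + int (card S) - 2)" for f n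
  proof -
    have "vec_ord_ge (- val_dz P - of_bool (P \<in> S) - (if P = P0 then n else 0)) (loc P (h *s f)) \<longleftrightarrow>
        vec_ord_ge (if P = P0 then - (n + int (card S) - 2) else 0) (loc P f)" for P
    proof -
      \<comment> \<open>At \<open>P0\<close> the bound is -1 - n - (card S - 3) = -(n + card S - 2);
        everywhere else it becomes 0.\<close>
      have "- val_dz P - of_bool (P \<in> S) - (if P = P0 then n else 0) - fls_subdegree (ratfun_at P h)
          = (if P = P0 then - (n + int (card S) - 2) else 0)"
        using vh[of P] P0 by (auto simp: val_def)
      thus ?thesis using h0 by (simp only: loc_scale vec_ord_ge_scale_iff ratfun_at_eq_0_iff not_False_eq_True)
    qed
    thus ?thesis by (simp only: Esec_def Msec_def sec_def mem_Collect_eq)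
  qed
  have "Esec n = (\<lambda>f. h *s f) ` Msec (n + int (card S) - 2)" for n
  proof (intro equalityI subsetI)
    fix w assume "w \<in> Esec n"
    moreover have "w = h *s (inverse h *s w)" using h0 by (simp add: vector_smult_assoc)
    ultimately show "w \<in> (\<lambda>f. h *s f) ` Msec (n + int (card S) - 2)" using mem by (metis imageI)
  qed (use mem in auto)
  with h0 show ?thesis using that by blast
qed

end

lemmas rank_nullity_gscale =
  vector_space_pair.has_dim_rank_nullity[OF vector_space_pair.intro[OF vector_space_gscale vector_space_vec]]

lemmas injective_image_gscale =
  vector_space_pair.has_dim_injective_image[OF vector_space_pair.intro[OF vector_space_gscale vector_space_gscale]]

lemma subspace_image_gscale:
  assumes f: "Vector_Spaces.linear gscale (*s) f" and X: "gs.subspace X"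
  shows "vec.subspace (f ` X :: (complex ^ 'm) set)"
proof -
  interpret f: Vector_Spaces.linear gscale "(*s)" f by (rule f)
  show ?thesis using X by (rule f.subspace_image)
qed

section \<open>Growth of the spaces of sections with the pole order at \<open>P0\<close>\<close>

context fuchsian_connection_at
begin

text \<open>The entries of a section have poles bounded by \<open>k P\<close>. The function
  \<open>h\<close> moves these poles to \<open>P0\<close>, and if the section vanishes there to high
  enough order, each product is without poles and has a zero, hence is 0.\<close>

lemma Msec_trivial: "\<exists>n. Msec n = {0}"
proof -
  obtain k where k: "finite {P. k P \<noteq> 0}" "\<And>P. k P \<ge> 0"
    "\<And>P i j. ord_ge (- k P) (G P $ i $ j)" "\<And>P i j. ord_ge (- k P) (H P $ i $ j)"
    by (rule gauge_bounds) blast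
  define T where "T = {P. k P \<noteq> 0} - {P0}"
  define h where "h = (\<Prod>P\<in>T. pole_zero P0 P powi k P)"
  have T: "finite T" using k(1) by (simp add: T_def)
  have h0: "h \<noteq> 0" using T by (simp add: h_def)
  have vh: "val P h = (\<Sum>Q\<in>T. k Q * (of_bool (P = Q) - of_bool (P = P0)))" for P
    unfolding h_def using T by (subst val_prod) (auto simp: val_powi val_pole_zero)
  have vh1: "val P h \<ge> k P" if "P \<noteq> P0" for P
  proof -
    have "val P h = (\<Sum>Q\<in>T. if P = Q then k Q else 0)"
      unfolding vh using that by (intro sum.cong) auto
    thus ?thesis using T that k(2)[of P] by (auto simp: T_def)
  qed
  \<comment> \<open>Chosen so that the order of \<open>h * f $ i\<close> at \<open>P0\<close> is at
    least val P0 h + n - k P0 = 1.\<close>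
  define n where "n = 1 - val P0 h + k P0"
  have "f = 0" if f: "f \<in> Msec (- n)" for f
  proof -
    have e: "expand P f = G P *v loc P f" for P by (simp add: loc_def)
    have "vec_ord_ge (n - k P0) (expand P0 f)" unfolding e using f k(3) by (intro vec_ord_ge_matrix) (auto simp: Msec_iff)
    hence e0: "ord_ge (n - k P0) (ratfun_at P0 (f $ i))" for i by (simp add: vec_ord_ge_def expand_def)
    have "vec_ord_ge (- k P) (expand P f)" if "P \<noteq> P0" for P
      unfolding e using f k(3) that by (intro vec_ord_ge_matrix[of "- k P" _ 0]) (auto simp: Msec_iff)
    hence e1: "ord_ge (- k P) (ratfun_at P (f $ i))" if "P \<noteq> P0" for P i using that by (simp add: vec_ord_ge_def expand_def)
    have "h * f $ i = 0" for i
    proof (rule ratfun_eq_0I)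
      have h1: "ord_ge (val P h) (ratfun_at P h)" for P by (simp add: ord_ge_ratfun_iff)
      show p1: "ord_ge 1 (ratfun_at P0 (h * f $ i))" unfolding ratfun_at_mult
        by (rule ord_ge_mult'[OF h1 e0]) (simp add: n_def)
      show "ord_ge 0 (ratfun_at P (h * f $ i))" for P
      proof (cases "P = P0")
        case True
        thus ?thesis using ord_ge_mono[OF p1, of 0] by simp
      next
        case False
        show ?thesis unfolding ratfun_at_mult
          by (rule ord_ge_mult'[OF h1 e1[OF False]]) (use vh1[OF False] in simp)
      qed
    qed
    thus "f = 0" using h0 by (simp add: vec_eq_iff)
  qed
  moreover have "0 \<in> Msec (- n)" by (simp add: Msec_iff)
  ultimately show ?thesis by blast
qed

lemma Msec_leading_kernel: "{f \<in> Msec (n + 1). vec_coeff (loc P0 f) (- (n + 1)) = 0} = Msec n"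
proof -
  have "vec_ord_ge (- (n + 1)) v \<and> vec_coeff v (- (n + 1)) = 0 \<longleftrightarrow> vec_ord_ge (- n) v" for v :: "complex fls ^ 'm"
  proof -
    have "k < - n \<longleftrightarrow> k < - (n + 1) \<or> k = - (n + 1)" for k by auto
    thus ?thesis unfolding vec_ord_ge_iff_vec_coeff by metis
  qed
  thus ?thesis unfolding set_eq_iff mem_Collect_eq Msec_iff by blast
qed

text \<open>Rank-nullity for the leading coefficient at \<open>P0\<close>, whose kernel is the
  previous space.\<close>

lemma has_dim_Msec_Suc:
  assumes "has_dim gscale (Msec n) d"
  shows "has_dim gscale (Msec (n + 1)) (d + vec.dim ((\<lambda>f. vec_coeff (loc P0 f) (- (n + 1))) ` Msec (n + 1)))"
proof (rule rank_nullity_gscale[OF linear_coefficient subspace_Msec])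
  show "has_dim gscale {f \<in> Msec (n + 1). vec_coeff (loc P0 f) (- (n + 1)) = 0} d"
    using assms by (simp only: Msec_leading_kernel)
qed (rule vec_has_dim[OF subspace_image_gscale[OF linear_coefficient subspace_Msec]])

definition dim_Msec :: "int \<Rightarrow> nat" where
  "dim_Msec n = gs.dim (Msec n)"

text \<open>Climb from a trivial \<open>Msec N\<close> one pole order at a time; below
  \<open>N\<close> all spaces are trivial.\<close>

lemma has_dim_Msec: "has_dim gscale (Msec n) (dim_Msec n)"
proof -
  have "\<exists>d. has_dim gscale (Msec n) d"
  proof -
    obtain N where N: "Msec N = {0}" using Msec_trivial by blast
    have "\<exists>d. has_dim gscale (Msec (N + int k)) d" for k
    proof (induction k)
      case 0
      show ?case using has_dim_zero[OF vector_space_gscale] by (auto simp: N)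
    next
      case (Suc k)
      thus ?case using has_dim_Msec_Suc[of "N + int k"] by (auto simp: algebra_simps)
    qed
    from this[of "nat (n - N)"] show ?thesis
    proof (cases "n \<ge> N")
      case False
      hence "Msec n \<subseteq> {0}" using Msec_mono[of n N] N by simp
      hence "Msec n = {0}" using gs.subspace_0[OF subspace_Msec] by blast
      thus ?thesis using has_dim_zero[OF vector_space_gscale] by metis
    qed simp
  qed
  thus ?thesis unfolding dim_Msec_def using has_dim_imp_dim[OF vector_space_gscale] by metis
qed

lemma Esec_exhaustive:
  assumes "\<And>P. P \<noteq> P0 \<Longrightarrow> vec_ord_ge (- of_bool (P \<in> S)) (dz P *s loc P w)"
  shows "\<exists>n. w \<in> Esec n"
proof -
  obtain n where "n \<ge> 0" "vec_ord_ge (- n) (dz P0 *s loc P0 w)" using vec_ord_ge_exists by blast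
  hence "w \<in> Esec n" using assms by (auto simp: Esec_iff intro: vec_ord_ge_mono[of "- n"])
  thus ?thesis ..
qed

text \<open>This takes the place of a cohomology vanishing theorem. Vectors \<open>F i\<close> with
  prescribed values at \<open>P0\<close> exist if poles at an auxiliary point \<open>P1\<close> are
  allowed. A function with divisor n (P1 - P0) cancels those poles once \<open>n\<close> is large,
  and turns the values at \<open>P0\<close> into leading coefficients at index
  \<open>- n\<close>.\<close>

lemma leading_surjective:
  "\<exists>n0. \<forall>n\<ge>n0. (\<lambda>f. vec_coeff (loc P0 f) (- n)) ` Msec n = UNIV"
proof -
  define P1 where "P1 = (if P0 = Infinity then Finite 0 else Infinity)"
  have P1: "P1 \<noteq> P0" by (auto simp: P1_def)
  have "\<exists>f. vec_ord_ge 1 (loc P0 f - axis i 1) \<and> (\<forall>P. P \<noteq> P0 \<and> P \<noteq> P1 \<longrightarrow> vec_ord_ge 0 (loc P f))" for i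
    using loc_approximation[of "{P0}" P1 1 "\<lambda>_. axis i 1"] P1 by auto
  then obtain F where F: "\<And>i. vec_ord_ge 1 (loc P0 (F i) - axis i 1)"
    "\<And>i P. P \<noteq> P0 \<Longrightarrow> P \<noteq> P1 \<Longrightarrow> vec_ord_ge 0 (loc P (F i))" by metis
  define k where "k i = (SOME n. n \<ge> 0 \<and> vec_ord_ge (- n) (loc P1 (F i)))" for i
  have "k i \<ge> 0 \<and> vec_ord_ge (- k i) (loc P1 (F i))" for i
    unfolding k_def by (rule someI_ex) (rule vec_ord_ge_exists)
  hence k: "k i \<ge> 0" "vec_ord_ge (- k i) (loc P1 (F i))" for i by simp_all
  have le: "k i \<le> sum k UNIV" for i by (rule member_le_sum) (simp_all add: k(1))
  have "(\<lambda>f. vec_coeff (loc P0 f) (- n)) ` Msec n = UNIV" if n: "n \<ge> sum k UNIV" for n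
  proof (rule vec_subspace_axis)
    show "vec.subspace ((\<lambda>f. vec_coeff (loc P0 f) (- n)) ` Msec n)"
      by (rule subspace_image_gscale[OF linear_coefficient subspace_Msec])
    define h where "h = pole_zero P0 P1 powi n"
    have h0: "h \<noteq> 0" by (simp add: h_def)
    have vh: "val P h = n * (of_bool (P = P1) - of_bool (P = P0))" for P
      by (simp add: h_def val_powi val_pole_zero)
    have gh: "ord_ge (val P h) (ratfun_at P h)" for P by (simp add: ord_ge_ratfun_iff)
    define l where "l = fls_nth (ratfun_at P0 h) (- n)"
    have "val P0 h = - n" using vh[of P0] P1 by simp
    hence l: "l \<noteq> 0" unfolding l_def using h0 by (metis nth_fls_subdegree_nonzero ratfun_at_eq_0_iff val_def)
    fix i
    have ax: "vec_ord_ge 0 (axis i 1 :: complex fls ^ 'm)" by (simp add: vec_ord_ge_def axis_def ord_ge_def)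
    have v0: "vec_ord_ge 0 (loc P0 (F i))"
      using vec_ord_ge_add[OF vec_ord_ge_mono[OF F(1)[of i], of 0] ax] by simp
    have c0: "vec_coeff (loc P0 (F i)) 0 = axis i 1"
    proof -
      have "vec_coeff (loc P0 (F i) - axis i 1) 0 = 0" using F(1)[of i] by (simp add: vec_ord_ge_iff_vec_coeff)
      hence "vec_coeff (loc P0 (F i)) 0 = vec_coeff (axis i 1) 0" by (simp add: vec_coeff_diff)
      also have "\<dots> = axis i 1" by (simp add: vec_coeff_def axis_def vec_eq_iff)
      finally show ?thesis .
    qed
    define f where "f = gscale (1 / l) (h *s F i)"
    have "h *s F i \<in> Msec n"
      unfolding Msec_iff
    proof (intro conjI allI impI)
      show "vec_ord_ge (- n) (loc P0 (h *s F i))" unfolding loc_scale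
        by (rule vec_ord_ge_scale[OF gh v0]) (use \<open>val P0 h = - n\<close> in simp)
      fix P assume P: "P \<noteq> P0"
      show "vec_ord_ge 0 (loc P (h *s F i))" unfolding loc_scale
      proof (cases "P = P1")
        case True
        show "vec_ord_ge 0 (ratfun_at P h *s loc P (F i))"
          by (rule vec_ord_ge_scale[OF gh k(2)[folded True]]) (use vh[of P] P P1 True le[of i] n in simp)
      next
        case False
        show "vec_ord_ge 0 (ratfun_at P h *s loc P (F i))"
          by (rule vec_ord_ge_scale[OF gh F(2)[OF P False]]) (use vh[of P] P False in simp)
      qed
    qed
    hence "f \<in> Msec n" unfolding f_def by (rule gs.subspace_scale[OF subspace_Msec])
    moreover have "vec_coeff (loc P0 f) (- n) = axis i 1"
    proof -
      have "vec_coeff (loc P0 (h *s F i)) (- n + 0) = l *s axis i 1"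
        unfolding loc_scale l_def c0[symmetric]
        by (rule vec_coeff_leading_scale[OF _ v0]) (use gh[of P0] \<open>val P0 h = - n\<close> in simp)
      moreover have "vec_coeff (loc P0 f) (- n) = (1 / l) *s vec_coeff (loc P0 (h *s F i)) (- n)"
        by (simp only: f_def gscale_def loc_const vec_coeff_const)
      ultimately show ?thesis using l by (simp add: vector_smult_assoc)
    qed
    ultimately show "axis i 1 \<in> (\<lambda>f. vec_coeff (loc P0 f) (- n)) ` Msec n" by (metis imageI)
  qed
  thus ?thesis by blast
qed

text \<open>The slope is the rank; the constant term, which would involve the degree of
  \<open>M\<close>, is left undetermined and will cancel.\<close>

lemma dim_Msec_eventually_linear:
  "\<exists>n0. \<forall>n\<ge>n0. \<forall>k. dim_Msec (n + int k) = dim_Msec n + k * CARD('m)"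
proof -
  obtain n0 where n0: "\<And>n. n \<ge> n0 \<Longrightarrow> (\<lambda>f. vec_coeff (loc P0 f) (- n)) ` Msec n = UNIV"
    using leading_surjective by blast
  have step: "dim_Msec (n + 1) = dim_Msec n + CARD('m)" if "n \<ge> n0" for n
  proof -
    have "has_dim gscale (Msec (n + 1)) (dim_Msec n + CARD('m))"
      using has_dim_Msec_Suc[OF has_dim_Msec, of n] n0[of "n + 1"] that by (simp add: vec_dim_card del: vec.dim_UNIV)
    from has_dim_imp_dim[OF vector_space_gscale this] show ?thesis by (simp add: dim_Msec_def)
  qed
  have "dim_Msec (n + int k) = dim_Msec n + k * CARD('m)" if "n \<ge> n0" for n k
  proof (induction k)
    case (Suc k)
    have "dim_Msec (n + int (Suc k)) = dim_Msec ((n + int k) + 1)" by (simp add: algebra_simps)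
    also have "\<dots> = dim_Msec (n + int k) + CARD('m)" using that by (intro step) simp
    finally show ?case using Suc by simp
  qed simp
  thus ?thesis by blast
qed

lemma has_dim_Esec: "has_dim gscale (Esec n) (dim_Msec (n + int (card S) - 2))"
proof -
  obtain h where h: "h \<noteq> 0" "\<And>n. Esec n = (\<lambda>f. h *s f) ` Msec (n + int (card S) - 2)"
    by (rule Esec_scaled_Msec) blast
  have "inj_on (\<lambda>f. h *s f) (Msec (n + int (card S) - 2))"
    using h(1) by (auto simp: inj_on_def vec_eq_iff)
  thus ?thesis unfolding h(2) by (rule injective_image_gscale[OF linear_scale _ has_dim_Msec])
qed

end

section \<open>Local exactness in terms of residues\<close>

context fuchsian_connection
begin

lemma fuchsian_nabla_holomorphic:
  assumes "vec_ord_ge 0 v"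
  shows "vec_ord_ge (- of_bool (P \<in> S)) (fuchsian_nabla (R P) v)"
  unfolding vec_ord_ge_iff_vec_coeff
proof (intro allI impI)
  fix k :: int assume k: "k < - of_bool (P \<in> S)"
  have c: "vec_coeff (fuchsian_nabla (R P) v) k = of_int (k + 1) *s vec_coeff v (k + 1) + R P *v vec_coeff v (k + 1)"
    using vec_coeff_fuchsian_nabla[of "R P" v "k + 1"] by simp
  show "vec_coeff (fuchsian_nabla (R P) v) k = 0"
  proof (cases "k + 1 < 0")
    case True
    hence "vec_coeff v (k + 1) = 0" using assms unfolding vec_ord_ge_iff_vec_coeff by blast
    thus ?thesis using c by simp
  next
    case False
    hence "k = - 1" "P \<notin> S" using k by (auto simp: of_bool_def split: if_splits)
    thus ?thesis using c regular[of P] by simp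
  qed
qed

text \<open>Solve (n + \<open>R P\<close>) u = x coefficient by coefficient; only n = 0 needs the
  assumption on the residue.\<close>

lemma fuchsian_nabla_surjective:
  assumes "vec_coeff x (- 1) \<in> range ((*v) (R P))"
  obtains v where "x = fuchsian_nabla (R P) v"
proof -
  \<comment> \<open>Insisting on u = 0 for a vanishing right-hand side ensures that the solution has
    only finitely many negative exponents, so that it is a Laurent series.\<close>
  have "\<exists>u. of_int n *s u + R P *v u = vec_coeff x (n - 1) \<and> (vec_coeff x (n - 1) = 0 \<longrightarrow> u = 0)" for n
  proof (cases "vec_coeff x (n - 1) = 0")
    case True thus ?thesis by (intro exI[of _ 0]) simp
  next
    case False
    show ?thesis
    proof (cases "n = 0")
      case True
      then obtain u where "vec_coeff x (n - 1) = R P *v u" using assms by auto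
      thus ?thesis using True False by (intro exI[of _ u]) simp
    next
      case n: False
      thus ?thesis using coefficient_surjective[of n P "vec_coeff x (n - 1)"] False by blast
    qed
  qed
  then obtain u where u: "\<And>n. of_int n *s u n + R P *v u n = vec_coeff x (n - 1)"
    "\<And>n. vec_coeff x (n - 1) = 0 \<Longrightarrow> u n = 0" by metis
  obtain K where K: "K \<ge> 0" "vec_ord_ge (- K) x" using vec_ord_ge_exists by blast
  define v where "v = (\<chi> i. fls_shift K (fps_to_fls (Abs_fps (\<lambda>j. u (int j - K) $ i))))"
  have "vec_coeff v n = u n" for n
  proof (cases "n + K < 0")
    case True
    hence "vec_coeff x (n - 1) = 0" using K(2) unfolding vec_ord_ge_iff_vec_coeff by simp
    hence "u n = 0" by (rule u(2))
    thus ?thesis using True by (simp add: vec_coeff_def v_def vec_eq_iff)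
  qed (simp add: vec_coeff_def v_def vec_eq_iff)
  hence "vec_coeff (fuchsian_nabla (R P) v) n = vec_coeff x n" for n
    using vec_coeff_fuchsian_nabla[of "R P" v "n + 1"] u(1)[of "n + 1"] by simp
  hence "x = fuchsian_nabla (R P) v" by (intro vec_coeff_eqI) simp
  thus ?thesis by (rule that)
qed

text \<open>The residue of an exact form is \<open>R P\<close> applied to coefficient 0 of the
  primitive; conversely \<open>fuchsian_nabla_surjective\<close> supplies a primitive.\<close>

lemma locally_exact_form_iff:
  "form_at P w \<in> range (nabla_at A P) \<longleftrightarrow> vec_coeff (dz P *s loc P w) (- 1) \<in> range ((*v) (R P))"
proof -
  have f: "form_at P w = G P *v (dz P *s loc P w)"
    by (simp add: form_at_eq loc_def vec.scale)
  show ?thesis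
  proof
    assume "form_at P w \<in> range (nabla_at A P)"
    then obtain y where "form_at P w = nabla_at A P y" by blast
    hence "G P *v (dz P *s loc P w) = G P *v fuchsian_nabla (R P) (H P *v y)"
      using gauge[of P "H P *v y"] f by simp
    hence "dz P *s loc P w = fuchsian_nabla (R P) (H P *v y)" by (metis GHv(2))
    thus "vec_coeff (dz P *s loc P w) (- 1) \<in> range ((*v) (R P))"
      using vec_coeff_fuchsian_nabla[of "R P" "H P *v y" 0] by simp
  next
    assume "vec_coeff (dz P *s loc P w) (- 1) \<in> range ((*v) (R P))"
    then obtain v where "dz P *s loc P w = fuchsian_nabla (R P) v" by (rule fuchsian_nabla_surjective)
    hence "form_at P w = nabla_at A P (G P *v v)" by (simp add: f gauge)
    thus "form_at P w \<in> range (nabla_at A P)" by blast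
  qed
qed

end

section \<open>Reduction of locally exact forms to bounded poles, and the count of
  dimensions\<close>

context fuchsian_connection_at
begin

lemma range_R_P0: "range ((*v) (R P0)) = UNIV"
  using coefficient_surjective[of 0 P0] inj_R by (auto simp: surj_def image_iff) metis

text \<open>One global \<open>f\<close> approximates local primitives of \<open>w\<close> at the
  finitely many bad points other than \<open>P0\<close>, and is holomorphic in gauge coordinates at
  the remaining ones. Only the pole at \<open>P0\<close> stays unbounded.\<close>

lemma locally_exact_reduction:
  assumes "w \<in> locally_exact"
  shows "\<exists>f n. w - nabla A f \<in> Esec n"
proof -
  define T where "T = (S \<union> {Infinity} \<union> {P. \<not> vec_ord_ge 0 (loc P w)}) - {P0}"
  have T: "finite T" "P0 \<notin> T" using finite_S finite_loc_nonholomorphic by (auto simp: T_def)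
  have "\<exists>v. dz P *s loc P w = fuchsian_nabla (R P) v" for P
  proof -
    have "vec_coeff (dz P *s loc P w) (- 1) \<in> range ((*v) (R P))" using assms by (simp add: locally_exact_def res_def)
    from fuchsian_nabla_surjective[OF this] show ?thesis by blast
  qed
  then obtain v where v: "\<And>P. dz P *s loc P w = fuchsian_nabla (R P) (v P)" by metis
  obtain f where f: "\<And>P. P \<in> T \<Longrightarrow> vec_ord_ge 0 (loc P f - v P)"
    "\<And>P. P \<notin> T \<Longrightarrow> P \<noteq> P0 \<Longrightarrow> vec_ord_ge 0 (loc P f)"
    using loc_approximation[OF T, of 0 v] by blast
  have "vec_ord_ge (- of_bool (P \<in> S)) (dz P *s loc P (w - nabla A f))" if P: "P \<noteq> P0" for P
  proof (cases "P \<in> T")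
    case True
    \<comment> \<open>Since \<open>v P\<close> is a primitive of \<open>w\<close>, the error is the
      image of a holomorphic vector and so has at most a simple pole, on \<open>S\<close>.\<close>
    have "dz P *s loc P (w - nabla A f) = 0 - fuchsian_nabla (R P) (loc P f - v P)"
      by (simp add: loc_diff vector_ssub_ldistrib loc_nabla v fuchsian_nabla_diff)
    also have "vec_ord_ge (- of_bool (P \<in> S)) \<dots>"
      by (rule vec_ord_ge_diff[OF vec_ord_ge_0 fuchsian_nabla_holomorphic[OF f(1)[OF True]]])
    finally show ?thesis .
  next
    case False
    hence w: "vec_ord_ge 0 (loc P w)" "val_dz P = 0" "P \<notin> S" using P by (auto simp: T_def val_dz_def)
    have "vec_ord_ge 0 (dz P *s loc P w)"
      using w by (simp only: vec_ord_ge_scale_iff[OF fls_deriv_coord_at_nonzero] subdegree_dz diff_zero)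
    hence "vec_ord_ge (- of_bool (P \<in> S)) (dz P *s loc P w)" by (rule vec_ord_ge_mono) simp
    from vec_ord_ge_diff[OF this fuchsian_nabla_holomorphic[OF f(2)[OF False P]]]
    show ?thesis by (simp add: loc_diff vector_ssub_ldistrib loc_nabla)
  qed
  thus ?thesis using Esec_exhaustive by blast
qed

text \<open>The leading coefficient of \<open>w\<close> at \<open>P0\<close> is hit by - n +
  \<open>R P0\<close>, and for large \<open>n\<close> its preimage is the leading coefficient of
  some section in \<open>Msec n\<close>. Subtracting its image lowers the pole order by one, until
  the fixed bound is reached.\<close>

lemma Esec_reduction:
  "\<exists>n0. \<forall>n\<ge>n0. \<forall>k. \<forall>w\<in>Esec (n + int k). \<exists>f. w - nabla A f \<in> Esec n"
proof -
  obtain n0 where n0: "\<And>n. n \<ge> n0 \<Longrightarrow> (\<lambda>f. vec_coeff (loc P0 f) (- n)) ` Msec n = UNIV"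
    using leading_surjective by blast
  have step: "\<exists>f. w - nabla A f \<in> Esec (n - 1)" if n: "n \<ge> n0" and w: "w \<in> Esec n" for n w
  proof -
    obtain u where u: "of_int (- n) *s u + R P0 *v u = vec_coeff (dz P0 *s loc P0 w) (- n - 1)"
      using coefficient_surjective[of "- n" P0] inj_R by blast
    have "u \<in> (\<lambda>f. vec_coeff (loc P0 f) (- n)) ` Msec n" unfolding n0[OF n] ..
    then obtain g where g: "g \<in> Msec n" "vec_coeff (loc P0 g) (- n) = u" by (elim imageE) simp
    have E: "w - nabla A g \<in> Esec n"
      using w g(1) by (intro gs.subspace_diff[OF subspace_Esec]) (simp_all add: nabla_in_Esec_iff)
    have z: "vec_coeff (dz P0 *s loc P0 (w - nabla A g)) (- n - 1) = 0"
      using u g(2) vec_coeff_fuchsian_nabla[of "R P0" "loc P0 g" "- n"]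
      by (simp add: loc_diff vector_ssub_ldistrib loc_nabla vec_coeff_diff)
    have v: "vec_ord_ge (- n - 1) (dz P0 *s loc P0 (w - nabla A g))"
    proof -
      have eq: "- of_bool (P0 \<in> S) - (if P0 = P0 then n else 0) = - n - 1" using P0 by simp
      show ?thesis using E[unfolded Esec_iff, rule_format, of P0] unfolding eq .
    qed
    have lead: "vec_ord_ge (- n) (dz P0 *s loc P0 (w - nabla A g))"
      unfolding vec_ord_ge_iff_vec_coeff
    proof (intro allI impI)
      fix k assume "k < - n"
      show "vec_coeff (dz P0 *s loc P0 (w - nabla A g)) k = 0"
      proof (cases "k = - n - 1")
        case False
        hence "k < - n - 1" using \<open>k < - n\<close> by simp
        thus ?thesis using v unfolding vec_ord_ge_iff_vec_coeff by blast
      qed (simp only: z)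
    qed
    have "w - nabla A g \<in> Esec (n - 1)"
      unfolding Esec_iff
    proof
      fix P
      show "vec_ord_ge (- of_bool (P \<in> S) - (if P = P0 then n - 1 else 0)) (dz P *s loc P (w - nabla A g))"
      proof (cases "P = P0")
        case True
        hence eq: "- of_bool (P \<in> S) - (if P = P0 then n - 1 else 0) = - n" using P0 by simp
        show ?thesis unfolding eq using lead True by simp
      next
        case False
        hence eq: "(if P = P0 then n - 1 else 0) = (if P = P0 then n else 0)" by simp
        show ?thesis unfolding eq by (rule E[unfolded Esec_iff, rule_format])
      qed
    qed
    thus ?thesis ..
  qed
  have "\<forall>w\<in>Esec (n + int k). \<exists>f. w - nabla A f \<in> Esec n" if n: "n \<ge> n0" for n k
  proof (induction k)
    case 0
    have z: "nabla A 0 = 0" by (simp add: nabla_eq_0_iff)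
    show ?case
    proof
      fix w assume "w \<in> Esec (n + int 0)"
      hence "w - nabla A 0 \<in> Esec n" by (simp add: z)
      thus "\<exists>f. w - nabla A f \<in> Esec n" ..
    qed
  next
    case (Suc k)
    show ?case
    proof
      fix w assume "w \<in> Esec (n + int (Suc k))"
      moreover have "n0 \<le> n + int (Suc k)" using n by simp
      ultimately obtain f where "w - nabla A f \<in> Esec (n + int (Suc k) - 1)" using step by blast
      moreover have "n + int (Suc k) - 1 = n + int k" by simp
      ultimately have "w - nabla A f \<in> Esec (n + int k)" by (simp only:)
      then obtain g where "w - nabla A f - nabla A g \<in> Esec n" using Suc by blast
      hence "w - nabla A (f + g) \<in> Esec n" by (simp only: nabla_add diff_diff_add)
      thus "\<exists>f. w - nabla A f \<in> Esec n" ..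
    qed
  qed
  thus ?thesis by blast
qed

text \<open>Hence the conditions imposed by local exactness at the points of \<open>S - {P0}\<close> are independent on
  \<open>Esec n\<close> for large \<open>n\<close>.\<close>

lemma residue_independence:
  "\<exists>n0. \<forall>n\<ge>n0. \<forall>P\<in>S - {P0}. (res P) ` {w \<in> Esec n. \<forall>Q\<in>S - {P0, P}. res Q w = 0} = UNIV"
proof -
  have "\<exists>n. \<exists>w\<in>Esec n. res P w = axis i 1 \<and> (\<forall>Q\<in>S - {P0, P}. res Q w = 0)" if P: "P \<in> S - {P0}" for P i
  proof -
    define T where "T = (S \<union> {Infinity}) - {P0}"
    have T: "finite T" "P0 \<notin> T" using finite_S by (auto simp: T_def)
    \<comment> \<open>The local form dt/t times a unit vector; \<open>v\<close> divides it by dz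
      because \<open>loc\<close> refers to coefficients of dz.\<close>
    define x :: "complex fls ^ 'm" where "x = fls_X_inv *s axis i 1"
    define v where "v Q = (if Q = P then inverse (dz P) *s x else 0)" for Q
    have dv: "dz Q *s v Q = (if Q = P then x else 0)" for Q
      using fls_deriv_coord_at_nonzero[of Q] by (auto simp: v_def vector_smult_assoc)
    \<comment> \<open>Precision 2 outweighs the double pole of dz at infinity, so the error of the
      form is holomorphic and residues are matched exactly.\<close>
    obtain w where w: "\<And>Q. Q \<in> T \<Longrightarrow> vec_ord_ge 2 (loc Q w - v Q)"
      "\<And>Q. Q \<notin> T \<Longrightarrow> Q \<noteq> P0 \<Longrightarrow> vec_ord_ge 0 (loc Q w)"
      using loc_approximation[OF T, of 2 v] by blast
    have near: "vec_ord_ge 0 (dz Q *s loc Q w - (if Q = P then x else 0))" if "Q \<in> T" for Q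
    proof -
      have "dz Q *s loc Q w - (if Q = P then x else 0) = dz Q *s (loc Q w - v Q)"
        by (simp only: vector_ssub_ldistrib dv)
      moreover have "vec_ord_ge 0 (dz Q *s (loc Q w - v Q))"
        unfolding vec_ord_ge_scale_iff[OF fls_deriv_coord_at_nonzero] subdegree_dz
        by (rule vec_ord_ge_mono[OF w(1)[OF that]]) (simp add: val_dz_def)
      ultimately show ?thesis by simp
    qed
    have x1: "vec_coeff x (- 1) = axis i 1" "vec_ord_ge (- 1) x"
      by (auto simp: x_def vec_coeff_def vec_eq_iff axis_def vec_ord_ge_def ord_ge_def)
    have PT: "Q \<in> T" if "Q \<in> S - {P0}" for Q using that by (auto simp: T_def)
    have r: "res Q w = (if Q = P then axis i 1 else 0)" if "Q \<in> S - {P0}" for Q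
    proof -
      have "vec_coeff (dz Q *s loc Q w - (if Q = P then x else 0)) (- 1) = 0"
        using near[OF PT[OF that]] by (simp add: vec_ord_ge_iff_vec_coeff)
      thus ?thesis using x1(1) by (auto simp: res_def vec_coeff_diff split: if_splits)
    qed
    have "vec_ord_ge (- of_bool (Q \<in> S)) (dz Q *s loc Q w)" if Q: "Q \<noteq> P0" for Q
    proof (cases "Q \<in> T")
      case True
      have "vec_ord_ge (- of_bool (Q \<in> S)) (if Q = P then x else 0)" using x1(2) P by auto
      from vec_ord_ge_add[OF vec_ord_ge_mono[OF near[OF True]] this] show ?thesis by simp
    next
      case False
      hence "Q \<notin> S" "val_dz Q = 0" using Q by (auto simp: T_def val_dz_def)
      thus ?thesis using w(2)[OF False Q]
        by (simp add: vec_ord_ge_scale_iff[OF fls_deriv_coord_at_nonzero] subdegree_dz)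
    qed
    then obtain n where "w \<in> Esec n" using Esec_exhaustive by blast
    thus ?thesis using r P by (intro exI[of _ n] bexI[of _ w]) auto
  qed
  then obtain N where N: "\<And>P i. P \<in> S - {P0} \<Longrightarrow>
    \<exists>w\<in>Esec (N P i). res P w = axis i 1 \<and> (\<forall>Q\<in>S - {P0, P}. res Q w = 0)" by metis
  define n0 where "n0 = Max (insert 0 ((\<lambda>(P, i). N P i) ` (S \<times> UNIV)))"
  have n0: "N P i \<le> n0" if "P \<in> S" for P i
    unfolding n0_def using finite_S that by (intro Max_ge) (auto intro!: finite_imageI)
  have "(res P) ` {w \<in> Esec n. \<forall>Q\<in>S - {P0, P}. res Q w = 0} = UNIV"
    if n: "n \<ge> n0" and P: "P \<in> S - {P0}" for n P
  proof (rule vec_subspace_axis)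
    have "gs.subspace {w \<in> Esec n. \<forall>Q\<in>S - {P0, P}. res Q w = 0}"
      using gs.subspace_0[OF subspace_Esec] gs.subspace_add[OF subspace_Esec] gs.subspace_scale[OF subspace_Esec]
        res_gscale[of _ 0 0]
      by (auto simp: gs.subspace_def res_add res_gscale)
    thus "vec.subspace ((res P) ` {w \<in> Esec n. \<forall>Q\<in>S - {P0, P}. res Q w = 0})"
      by (rule subspace_image_gscale[OF linear_res])
    fix i
    obtain w where w: "w \<in> Esec (N P i)" "res P w = axis i 1" "\<forall>Q\<in>S - {P0, P}. res Q w = 0"
      using N[OF P] by blast
    have "w \<in> Esec n" using w(1) Esec_mono[of "N P i" n] n n0[of P i] P by auto
    thus "axis i 1 \<in> (res P) ` {w \<in> Esec n. \<forall>Q\<in>S - {P0, P}. res Q w = 0}"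
      using w by (intro image_eqI[of _ _ w]) auto
  qed
  thus ?thesis by blast
qed

lemma dim_range_R: "vec.dim (range ((*v) (R P))) + t0 A P = CARD('m)"
proof -
  have k: "vec.subspace {u. R P *v u = 0}"
    by (auto simp: vec.subspace_def matrix_vector_right_distrib vec.scale)
  have r: "vec.subspace (range ((*v) (R P)))"
    using vec.subspace_UNIV by (rule vec.subspace_image)
  have "has_dim (*s) {u \<in> UNIV. R P *v u = 0} (t0 A P)"
    using vec_has_dim[OF k] by (simp only: t0_eq UNIV_I simp_thms)
  from vector_space_pair.has_dim_rank_nullity[OF vector_space_pair.intro[OF vector_space_vec vector_space_vec]
      matrix_vector_mul_linear_gen vec.subspace_UNIV this vec_has_dim[OF r]]
  have "has_dim (*s) (UNIV :: (complex ^ 'm) set) (t0 A P + vec.dim (range ((*v) (R P))))" .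
  from has_dim_imp_dim[OF vector_space_vec this] show ?thesis by (simp add: vec_dim_card del: vec.dim_UNIV)
qed

text \<open>The conditions are imposed one point at a time. By \<open>residue_independence\<close>
  the residue at the new point still takes all values, and restricting it to the range of
  \<open>R P\<close> lowers the dimension by \<open>t0 A P\<close>.\<close>

lemma has_dim_Esec_Int_locally_exact:
  "\<exists>n0. \<forall>n\<ge>n0. \<exists>e. has_dim gscale (Esec n \<inter> locally_exact) e \<and>
     e + (\<Sum>P\<in>S - {P0}. t0 A P) = dim_Msec (n + int (card S) - 2)"
proof -
  from residue_independence obtain n0 where
    "\<forall>n\<ge>n0. \<forall>P\<in>S - {P0}. (res P) ` {w \<in> Esec n. \<forall>Q\<in>S - {P0, P}. res Q w = 0} = UNIV" ..
  note n0 = this[rule_format]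
  have "\<exists>e. has_dim gscale (Esec n \<inter> locally_exact) e \<and> e + (\<Sum>P\<in>S - {P0}. t0 A P) = dim_Msec (n + int (card S) - 2)"
    if n: "n \<ge> n0" for n
  proof -
    define X where "X T = {w \<in> Esec n. \<forall>P\<in>T. res P w \<in> range ((*v) (R P))}" for T
    have r: "vec.subspace (range ((*v) (R P)))" for P
      using vec.subspace_UNIV by (rule vec.subspace_image)
    have sX: "gs.subspace (X T)" for T
      unfolding gs.subspace_def X_def
      using gs.subspace_0[OF subspace_Esec] gs.subspace_add[OF subspace_Esec] gs.subspace_scale[OF subspace_Esec]
        res_gscale[of _ 0 0] vec.subspace_0[OF r] vec.subspace_add[OF r] vec.subspace_scale[OF r]
      by (simp add: res_add res_gscale)
    have "\<exists>e. has_dim gscale (X T) e \<and> e + (\<Sum>P\<in>T. t0 A P) = dim_Msec (n + int (card S) - 2)"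
      if "finite T" "T \<subseteq> S - {P0}" for T
      using that
    proof (induction T)
      case empty
      thus ?case using has_dim_Esec[of n] by (auto simp: X_def)
    next
      case (insert P T)
      then obtain e where e: "has_dim gscale (X T) e"
        "e + (\<Sum>P\<in>T. t0 A P) = dim_Msec (n + int (card S) - 2)" by auto
      have surj: "\<exists>w\<in>X T. res P w = c" for c
      proof -
        obtain w where w: "w \<in> Esec n" "\<forall>Q\<in>S - {P0, P}. res Q w = 0" "res P w = c"
        proof -
          have "P \<in> S - {P0}" using insert.prems by simp
          hence "c \<in> (res P) ` {w \<in> Esec n. \<forall>Q\<in>S - {P0, P}. res Q w = 0}"
            using n0[OF n] by simp
          then obtain w where "c = res P w" "w \<in> {w \<in> Esec n. \<forall>Q\<in>S - {P0, P}. res Q w = 0}"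
            by (rule imageE)
          thus ?thesis using that[of w] by simp
        qed
        have "res Q w = 0" if "Q \<in> T" for Q using w(2) insert.hyps insert.prems that by auto
        hence "w \<in> X T" using w(1) vec.subspace_0[OF r] by (simp add: X_def)
        thus ?thesis using w(3) by blast
      qed
      \<comment> \<open>The common kernel of the residue at \<open>P\<close> before and after the
        new condition: the two dimensions are k + m and k + rank of \<open>R P\<close>.\<close>
      let ?K = "{w \<in> X T. res P w = 0}"
      have sK: "gs.subspace ?K"
        using sX[of T] res_gscale[of _ 0 0] by (auto simp: gs.subspace_def res_add res_gscale)
      have "?K \<subseteq> X T" by blast
      from has_dim_subset[OF vector_space_gscale e(1) sK this] obtain k where k: "has_dim gscale ?K k" .
      have "has_dim gscale (X T) (k + CARD('m))"
      proof (rule rank_nullity_gscale[OF linear_res sX k])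
        have "c \<in> res P ` X T" for c using surj[of c] by (simp add: image_iff) metis
        hence "res P ` X T = UNIV" by (simp add: set_eq_iff)
        thus "has_dim (*s) (res P ` X T) CARD('m)"
          using vec_has_dim[OF vec.subspace_UNIV] by (simp add: vec_dim_card del: vec.dim_UNIV)
      qed
      hence ek: "e = k + CARD('m)" using e(1) has_dim_imp_dim[OF vector_space_gscale] by metis
      have "has_dim gscale (X (insert P T)) (k + vec.dim (range ((*v) (R P))))"
      proof (rule rank_nullity_gscale[OF linear_res sX])
        have "{w \<in> X (insert P T). res P w = 0} = ?K" using vec.subspace_0[OF r] by (auto simp: X_def)
        thus "has_dim gscale {w \<in> X (insert P T). res P w = 0} k" using k by simp
        have "c \<in> res P ` X (insert P T)" if "c \<in> range ((*v) (R P))" for c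
        proof -
          obtain w where "w \<in> X T" "res P w = c" using surj by blast
          thus ?thesis using that by (intro image_eqI[of _ _ w]) (auto simp: X_def)
        qed
        hence "res P ` X (insert P T) = range ((*v) (R P))" by (auto simp: X_def)
        thus "has_dim (*s) (res P ` X (insert P T)) (vec.dim (range ((*v) (R P))))"
          using vec_has_dim[OF r] by simp
      qed
      thus ?case using ek e(2) dim_range_R[of P] insert.hyps by (intro exI[of _ "k + vec.dim (range ((*v) (R P)))"]) simp
    qed
    moreover have "X (S - {P0}) = Esec n \<inter> locally_exact"
    proof -
      \<comment> \<open>The remaining points impose nothing on \<open>Esec n\<close>: off
        \<open>S\<close> the residue is 0, and \<open>R P0\<close> is surjective.\<close>
      have "res P w \<in> range ((*v) (R P))" if "w \<in> Esec n" "P \<notin> S - {P0}" for w P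
      proof (cases "P = P0")
        case False
        hence "vec_ord_ge 0 (dz P *s loc P w)" using that by (auto simp: Esec_iff dest: spec[of _ P])
        hence "res P w = 0" by (simp add: res_def vec_ord_ge_iff_vec_coeff)
        thus ?thesis using vec.subspace_0[OF r] by simp
      qed (simp add: range_R_P0)
      thus ?thesis by (auto simp: X_def locally_exact_def)
    qed
    ultimately show ?thesis using finite_S by (metis finite_Diff order_refl)
  qed
  thus ?thesis by blast
qed

text \<open>\<open>Z\<close> is a complement of \<open>nabla A\<close> applied to
  \<open>Msec n\<close> inside the locally exact part of \<open>Esec n\<close>. By
  \<open>nabla_in_Esec_iff\<close> it meets exact forms only in 0, and by the two reductions it
  represents every class.\<close>

lemma locally_exact_modulo_exact:
  obtains Z d where "has_dim gscale Z d" "Z \<subseteq> locally_exact" "Z \<inter> range (nabla A) = {0}"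
    "\<And>w. w \<in> locally_exact \<Longrightarrow> \<exists>z\<in>Z. \<exists>f. w = z + nabla A f"
    "int d = (int (card S) - 2) * int CARD('m) - (\<Sum>P\<in>S - {P0}. int (t0 A P))"
proof -
  obtain n1 where n1: "\<And>n k. n \<ge> n1 \<Longrightarrow> dim_Msec (n + int k) = dim_Msec n + k * CARD('m)"
    using dim_Msec_eventually_linear by blast
  obtain n2 where n2: "\<And>n. n \<ge> n2 \<Longrightarrow> \<exists>e. has_dim gscale (Esec n \<inter> locally_exact) e \<and>
     e + (\<Sum>P\<in>S - {P0}. t0 A P) = dim_Msec (n + int (card S) - 2)"
    using has_dim_Esec_Int_locally_exact by blast
  obtain n3 where n3: "\<And>n k w. n \<ge> n3 \<Longrightarrow> w \<in> Esec (n + int k) \<Longrightarrow> \<exists>f. w - nabla A f \<in> Esec n"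
    using Esec_reduction by blast
  \<comment> \<open>Both dimensions are compared with that of \<open>Msec (n - 1)\<close>, since for
    a single singular point the index n + card S - 2 is n - 1.\<close>
  define n where "n = max (n1 + 1) (max n2 n3)"
  have nn: "n1 \<le> n - 1" "n2 \<le> n" "n3 \<le> n" by (simp_all add: n_def)
  obtain e where e: "has_dim gscale (Esec n \<inter> locally_exact) e"
    "e + (\<Sum>P\<in>S - {P0}. t0 A P) = dim_Msec (n + int (card S) - 2)"
    using n2[OF nn(2)] by blast
  define Y where "Y = nabla A ` Msec n"
  have dY: "has_dim gscale Y (dim_Msec n)"
    unfolding Y_def by (rule injective_image_gscale[OF linear_nabla linear_inj_nabla has_dim_Msec])
  have YE: "Y \<subseteq> Esec n \<inter> locally_exact" by (auto simp: Y_def nabla_in_Esec_iff nabla_in_locally_exact)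
  obtain y Z where Z: "y \<le> e" "has_dim gscale Y y" "has_dim gscale Z (e - y)" "Z \<subseteq> Esec n \<inter> locally_exact" "Y \<inter> Z = {0}"
    "\<And>x. x \<in> Esec n \<inter> locally_exact \<Longrightarrow> \<exists>y\<in>Y. \<exists>z\<in>Z. x = y + z"
    using has_dim_complement[OF vector_space_gscale e(1) has_dim_subspace[OF vector_space_gscale dY] YE] by metis
  have y: "y = dim_Msec n"
    using has_dim_imp_dim[OF vector_space_gscale] Z(2) dY by metis
  have "card S > 0" using P0 finite_S by (auto simp: card_gt_0_iff)
  then obtain k where k: "card S = Suc k" using gr0_implies_Suc by blast
  have "dim_Msec n = dim_Msec (n - 1) + CARD('m)"
    using n1[OF nn(1), of 1] by simp
  hence y': "int y = int (dim_Msec (n - 1)) + int CARD('m)" using y by simp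
  have eq: "n + int (card S) - 2 = n - 1 + int k" by (simp add: k)
  have "e + (\<Sum>P\<in>S - {P0}. t0 A P) = dim_Msec (n - 1) + k * CARD('m)"
    using e(2) n1[OF nn(1), of k] unfolding eq by simp
  hence "int e + (\<Sum>P\<in>S - {P0}. int (t0 A P)) = int (dim_Msec (n - 1)) + int k * int CARD('m)"
    by (metis of_nat_add of_nat_mult of_nat_sum)
  hence "int (e - y) = (int (card S) - 2) * int CARD('m) - (\<Sum>P\<in>S - {P0}. int (t0 A P))"
    using y' Z(1) by (simp add: of_nat_diff k algebra_simps)
  moreover have "\<exists>z\<in>Z. \<exists>f. w = z + nabla A f" if w: "w \<in> locally_exact" for w
  proof -
    obtain f k where f: "w - nabla A f \<in> Esec k" using locally_exact_reduction[OF w] by blast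
    have "w - nabla A f \<in> Esec (n + int (nat (k - n)))" using Esec_mono[of k "n + int (nat (k - n))"] f by auto
    then obtain g where g: "w - nabla A f - nabla A g \<in> Esec n" using n3[OF nn(3)] by blast
    moreover have "w - nabla A f - nabla A g \<in> locally_exact"
      using w by (intro gs.subspace_diff[OF subspace_locally_exact] nabla_in_locally_exact)
    ultimately obtain h z where "z \<in> Z" "w - nabla A f - nabla A g = nabla A h + z"
      using Z(6) unfolding Y_def by blast
    hence "w = z + nabla A (f + g + h)" by (simp add: nabla_add algebra_simps)
    thus ?thesis using \<open>z \<in> Z\<close> by blast
  qed
  moreover have "Z \<inter> range (nabla A) = {0}"
  proof -
    have "x = 0" if "x \<in> Z" "x \<in> range (nabla A)" for x
    proof -
      obtain f where "x = nabla A f" using \<open>x \<in> range (nabla A)\<close> by blast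
      moreover have "x \<in> Esec n" using \<open>x \<in> Z\<close> Z(4) by blast
      ultimately have "x \<in> Y" by (auto simp: Y_def nabla_in_Esec_iff)
      thus ?thesis using Z(5) \<open>x \<in> Z\<close> by blast
    qed
    moreover have "0 \<in> Z" using Z(5) by blast
    moreover have "0 = nabla A 0" by (simp add: nabla_eq_0_iff)
    ultimately show ?thesis by blast
  qed
  ultimately show ?thesis using that[of Z "e - y"] Z(3,4) by blast
qed

section \<open>Locally exact forms modulo exact forms\<close>

lemma coset_eq: "range (nabla A) +>\<^bsub>global_forms\<^esub> w = {nabla A f + w |f. True}"
  by (auto simp: a_r_coset_def r_coset_def global_forms_def type_space_def)

text \<open>Well-definedness of the induced map: changing \<open>w\<close> by an exact form changes
  its expansion by a locally exact one, so the union over representatives is a single coset.\<close>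

lemma localization_coset:
  "localization_map A (range (nabla A) +>\<^bsub>global_forms\<^esub> w) P = {nabla_at A P y + form_at P w |y. True}"
proof -
  have add: "nabla_at A P (y + y') = nabla_at A P y + nabla_at A P y'" for y y'
    by (simp add: nabla_at_def vec_eq_iff matrix_vector_right_distrib)
  have form: "form_at P (nabla A f + w) = nabla_at A P (expand P f) + form_at P w" for f
    by (simp add: form_at_eq expand_add vector_add_ldistrib nabla_at_expand)
  have loc: "range (nabla_at A P) +>\<^bsub>local_vectors\<^esub> x = {nabla_at A P y + x |y. True}" for x
    by (auto simp: a_r_coset_def r_coset_def local_vectors_def type_space_def)
  have "{nabla_at A P y + form_at P (nabla A f + w) |y. True} = {nabla_at A P y + form_at P w |y. True}" for f
  proof (intro equalityI subsetI)
    fix x assume "x \<in> {nabla_at A P y + form_at P (nabla A f + w) |y. True}"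
    then obtain y where "x = nabla_at A P (y + expand P f) + form_at P w" by (auto simp: form add add.assoc)
    thus "x \<in> {nabla_at A P y + form_at P w |y. True}" by blast
  next
    fix x assume "x \<in> {nabla_at A P y + form_at P w |y. True}"
    then obtain y where y: "x = nabla_at A P y + form_at P w" by blast
    have "nabla_at A P y = nabla_at A P (y - expand P f) + nabla_at A P (expand P f)"
      by (simp flip: add)
    hence "x = nabla_at A P (y - expand P f) + form_at P (nabla A f + w)" by (simp add: y form add.assoc)
    thus "x \<in> {nabla_at A P y + form_at P (nabla A f + w) |y. True}" by blast
  qed
  moreover have "localization_map A (range (nabla A) +>\<^bsub>global_forms\<^esub> w) P =
      (\<Union>f. {nabla_at A P y + form_at P (nabla A f + w) |y. True})"
    unfolding localization_map_def coset_eq loc by blast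
  ultimately show ?thesis by simp
qed

lemma carrier_lgl: "carrier (lgl A) = (\<lambda>w. range (nabla A) +>\<^bsub>global_forms\<^esub> w) ` locally_exact"
proof -
  have zero: "\<zero>\<^bsub>local_cokernel A P\<^esub> = range (nabla_at A P)" for P
    by (simp add: local_cokernel_def quotient_space_def)
  have diff: "nabla_at A P (y - y') = nabla_at A P y - nabla_at A P y'" for P y y'
    by (simp add: nabla_at_def vec_eq_iff matrix_vector_mult_diff_distrib)
  have add: "nabla_at A P (y + y') = nabla_at A P y + nabla_at A P y'" for P y y'
    by (simp add: nabla_at_def vec_eq_iff matrix_vector_right_distrib)
  have triv: "{nabla_at A P y + x |y. True} = range (nabla_at A P) \<longleftrightarrow> x \<in> range (nabla_at A P)" for P x
  proof
    assume eq: "{nabla_at A P y + x |y. True} = range (nabla_at A P)"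
    have "nabla_at A P 0 = 0" using diff[of P 0 0] by simp
    hence "x \<in> {nabla_at A P y + x |y. True}" by (auto intro!: exI[of _ 0])
    thus "x \<in> range (nabla_at A P)" unfolding eq .
  next
    assume "x \<in> range (nabla_at A P)"
    then obtain y0 where x: "x = nabla_at A P y0" by blast
    show "{nabla_at A P y + x |y. True} = range (nabla_at A P)"
    proof (intro equalityI subsetI)
      fix z assume "z \<in> range (nabla_at A P)"
      then obtain y where "z = nabla_at A P (y - y0) + x" by (auto simp: x diff)
      thus "z \<in> {nabla_at A P y + x |y. True}" by blast
    qed (auto simp: x simp flip: add)
  qed
  have "localization_map A (range (nabla A) +>\<^bsub>global_forms\<^esub> w) = (\<lambda>P. \<zero>\<^bsub>local_cokernel A P\<^esub>) \<longleftrightarrow> w \<in> locally_exact" for w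
    unfolding fun_eq_iff localization_coset zero triv locally_exact_def res_def locally_exact_form_iff by simp
  thus ?thesis
    by (auto simp: lgl_def global_cokernel_def quotient_space_def A_RCOSETS_def' global_forms_def type_space_def)
qed

text \<open>Each class in \<open>lgl A\<close> contains exactly one element of \<open>Z\<close>, so
  forming cosets is an isomorphism from \<open>Z\<close>.\<close>

lemma dim_lgl:
  "vectorspace.fin_dim complex_field (lgl A) \<and>
   int (vectorspace.dim complex_field (lgl A)) =
     (int (card S) - 2) * int CARD('m) - (\<Sum>P\<in>S - {P0}. int (t0 A P))"
proof -
  obtain Z d where Z: "has_dim gscale Z d" "Z \<subseteq> locally_exact" "Z \<inter> range (nabla A) = {0}"
    "\<And>w. w \<in> locally_exact \<Longrightarrow> \<exists>z\<in>Z. \<exists>f. w = z + nabla A f"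
    "int d = (int (card S) - 2) * int CARD('m) - (\<Sum>P\<in>S - {P0}. int (t0 A P))"
    by (rule locally_exact_modulo_exact) blast
  define T where "T w = range (nabla A) +>\<^bsub>global_forms\<^esub> w" for w
  have T: "T w = {nabla A f + w |f. True}" for w by (simp add: T_def coset_eq)
  have Teq: "T w = T w' \<longleftrightarrow> w - w' \<in> range (nabla A)" for w w'
  proof
    assume "T w = T w'"
    moreover have "w \<in> T w" using nabla_eq_0_iff[of 0] by (auto simp: T intro!: exI[of _ 0])
    ultimately obtain f where "w = nabla A f + w'" by (auto simp: T)
    thus "w - w' \<in> range (nabla A)" by simp
  next
    assume "w - w' \<in> range (nabla A)"
    then obtain f where f: "w = nabla A f + w'" by (metis diff_add_cancel imageE)
    show "T w = T w'"
    proof (intro equalityI subsetI)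
      fix x assume "x \<in> T w"
      then obtain g where "x = nabla A (g + f) + w'" by (auto simp: T f nabla_add add.assoc)
      thus "x \<in> T w'" unfolding T by blast
    next
      fix x assume "x \<in> T w'"
      then obtain g where "x = nabla A (g - f) + w" by (auto simp: T f nabla_diff)
      thus "x \<in> T w" unfolding T by blast
    qed
  qed
  have car: "carrier (lgl A) = T ` locally_exact" by (simp add: carrier_lgl T_def)
  have "vectorspace.fin_dim complex_field (lgl A) \<and> vectorspace.dim complex_field (lgl A) = d"
  proof (rule vectorspace_dim_eqI[OF vector_space_gscale Z(1)])
    have sZ: "gs.subspace Z" using has_dim_subspace[OF vector_space_gscale Z(1)] .
    show "bij_betw T Z (carrier (lgl A))"
      unfolding bij_betw_def
    proof
      show "inj_on T Z"
      proof (rule inj_onI)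
        fix x y assume xy: "x \<in> Z" "y \<in> Z" "T x = T y"
        hence "x - y \<in> Z \<inter> range (nabla A)" using gs.subspace_diff[OF sZ] Teq by blast
        thus "x = y" using Z(3) by simp
      qed
      have "T w \<in> T ` Z" if w: "w \<in> locally_exact" for w
      proof -
        obtain z f where z: "z \<in> Z" "w = z + nabla A f" using Z(4)[OF w] by blast
        hence "T w = T z" by (simp add: Teq)
        thus ?thesis using z(1) by blast
      qed
      thus "T ` Z = carrier (lgl A)" using Z(2) by (auto simp: car)
    qed
    show "T 0 = \<zero>\<^bsub>lgl A\<^esub>"
      by (auto simp: T lgl_def global_cokernel_def quotient_space_def)
    show "T (x + y) = T x \<oplus>\<^bsub>lgl A\<^esub> T y" for x y
    proof -
      have "T x \<oplus>\<^bsub>lgl A\<^esub> T y = {a + b |a b. a \<in> T x \<and> b \<in> T y}"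
        by (auto simp: lgl_def global_cokernel_def quotient_space_def set_add_def' global_forms_def type_space_def)
      also have "\<dots> = T (x + y)"
      proof (intro equalityI subsetI)
        fix c assume "c \<in> {a + b |a b. a \<in> T x \<and> b \<in> T y}"
        then obtain f g where "c = nabla A f + x + (nabla A g + y)" by (auto simp: T)
        hence "c = nabla A (f + g) + (x + y)" by (simp add: nabla_add)
        thus "c \<in> T (x + y)" unfolding T by blast
      next
        fix c assume "c \<in> T (x + y)"
        then obtain f where "c = nabla A f + (x + y)" by (auto simp: T)
        hence c: "c = (nabla A f + x) + (nabla A 0 + y)" using nabla_eq_0_iff[of 0] by simp
        show "c \<in> {a + b |a b. a \<in> T x \<and> b \<in> T y}" unfolding T using c by blast
      qed
      finally show ?thesis ..
    qed
    show "T (gscale c x) = c \<odot>\<^bsub>lgl A\<^esub> T x" for c x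
    proof -
      have "c \<odot>\<^bsub>lgl A\<^esub> T x = (\<Union>v\<in>T x. T (gscale c v))"
        by (simp add: lgl_def global_cokernel_def quotient_space_def T_def)
           (simp add: global_forms_def type_space_def gscale_def)
      \<comment> \<open>All representatives of a class give the same scaled coset, so the union in
        \<open>quotient_space\<close> collapses.\<close>
      also have "\<dots> = (\<Union>v\<in>T x. T (gscale c x))"
      proof (rule SUP_cong[OF refl])
        fix v assume "v \<in> T x"
        then obtain f where "v = nabla A f + x" by (auto simp: T)
        hence "gscale c v - gscale c x = nabla A (gscale c f)"
          by (simp add: nabla_gscale gs.scale_right_distrib)
        thus "T (gscale c v) = T (gscale c x)" by (simp add: Teq)
      qed
      also have "\<dots> = T (gscale c x)" by (auto simp: T)
      finally show ?thesis ..
    qed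
  qed
  thus ?thesis using Z(5) by simp
qed

end

lemma fuchsian_connection_exists:
  fixes A :: "complex poly fract ^ 'm ^ 'm"
  assumes "finite S" "regular_singular A S"
  obtains R G H where "fuchsian_connection A S R G H"
proof -
  have "\<forall>P. \<exists>R. local_form_at A P R \<and> (P \<notin> S \<longrightarrow> R = 0)"
    using assms(2) by (simp add: regular_singular_def)
  then obtain R where R: "\<And>P. local_form_at A P (R P)" "\<And>P. P \<notin> S \<Longrightarrow> R P = 0" by metis
  have "\<exists>G :: complex fls ^ 'm ^ 'm. invertible G \<and> (\<forall>i j. meromorphic_germ (G $ i $ j)) \<and>
        (\<forall>v. nabla_at A P (G *v v) = G *v fuchsian_nabla (R P) v)" for P
    using R(1)[of P] by (simp add: local_form_at_def)
  then obtain G :: "proj_point \<Rightarrow> complex fls ^ 'm ^ 'm" where G: "\<And>P. invertible (G P)" "\<And>P i j. meromorphic_germ (G P $ i $ j)"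
    "\<And>P v. nabla_at A P (G P *v v) = G P *v fuchsian_nabla (R P) v" by metis
  have "\<exists>H. G P ** H = mat 1 \<and> H ** G P = mat 1" for P using G(1)[of P] by (simp add: invertible_def)
  then obtain H where H: "\<And>P. G P ** H P = mat 1" "\<And>P. H P ** G P = mat 1" by metis
  have "fuchsian_connection A S R G H"
  proof
    fix P u ev assume "u \<noteq> 0" "R P *v u = ev *s u"
    thus "0 \<le> Re ev \<and> Re ev < 1" using R(1)[of P] unfolding local_form_at_def by blast
  qed (use assms G H R(2) in auto)
  thus ?thesis by (rule that)
qed

theorem proposition9p1:
  fixes A :: "complex poly fract ^ 'm ^ 'm"
    and r :: nat
    and p :: "nat \<Rightarrow> proj_point"
  assumes "r > 0"
    and "inj_on p {1..r}"
    and "regular_singular A (p ` {1..r})"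
    and "\<exists>i\<in>{1..r}. t0 A (p i) = 0"
  shows "vectorspace.fin_dim complex_field (lgl A) \<and>
         int (vectorspace.dim complex_field (lgl A)) =
           (int r - 2) * int CARD('m) - (\<Sum>i=1..r. int (t0 A (p i)))"
proof -
  define S where "S = p ` {1..r}"
  obtain i0 where i0: "i0 \<in> {1..r}" "t0 A (p i0) = 0" using assms(4) by blast
  obtain R G H where "fuchsian_connection A S R G H"
    using fuchsian_connection_exists[of S A] assms(3) by (auto simp: S_def)
  then interpret fuchsian_connection A S R G H .
  interpret fuchsian_connection_at A S R G H "p i0"
    by unfold_locales (use i0 injective_of_t0 in \<open>auto simp: S_def\<close>)
  have card: "card S = r" using assms(2) by (simp add: S_def card_image)
  \<comment> \<open>The chosen point may be put back into the sum because its \<open>t0\<close> is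
    0.\<close>
  have "(\<Sum>P\<in>S - {p i0}. int (t0 A P)) = (\<Sum>P\<in>S. int (t0 A P))"
    using i0 P0 finite_S by (simp add: sum.remove[of S "p i0"])
  also have "\<dots> = (\<Sum>i=1..r. int (t0 A (p i)))"
    using assms(2) by (simp add: S_def sum.reindex)
  finally show ?thesis using dim_lgl card by simp
qed

end
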